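(* Let $G$ be a graph and let $g = (\emptyset \to G \leftarrow \emptyset)$ be the corresponding morphism $\emptyset\to\emptyset$ of $\mathsf{Cospan}(\mathsf{UGraph})_{*}$. Then $$\mathrm{tw}(G) \;\le\; \mathrm{mtwd}(g) \;\le\; 2\cdot \mathrm{tw}(G).$$
   Context: A graph $G=(V,E,\mathrm{ends})$ consists of finite sets $V$ (vertices), $E$ (edges) and a function $\mathrm{ends}:E\to\{S\subseteq V: |S|\in\{1,2\}\}$. A tree is a connected acyclic graph. Tree width. A tree decomposition of $G$ is a pair $(Y,t)$ where $Y$ is a tree and $t:\mathrm{vertices}(Y)\to\mathcal P(V)$ satisfies: (1) $\bigcup_i t(i)=V$; (2) for every $e\in E$ there is $i$ with $\mathrm{ends}(e)\subseteq t(i)$; (3) whenever $j$ lies on the path from $i$ to $k$ in $Y$, $t(i)\cap t(k)\subseteq t(j)$. Its width is $\max_i |t(i)|$ (no $1$ is subtracted), and $\mathrm{tw}(G)$ is the minimum width of a tree decomposition of $G$. The category. $\mathsf{UGraph}$ has graphs as objects; a morphism $\alpha:G\to H$ is a pair of functions $\alpha_V$ (on vertices), $\alpha_E$ (on edges) with $\mathrm{ends}_H(\alpha_E(e))=\alpha_V(\mathrm{ends}_G(e))$. $\mathsf{Cospan}(\mathsf{UGraph})_{*}$ is the symmetric monoidal category whose objects are finite sets (regarded as discrete graphs) and whose morphisms $X\to Y$ are isomorphism classes of cospans $X\to G\leftarrow Y$ of graphs, i.e. a graph $G=(V,E)$ with functions $\partial_X:X\to V$, $\partial_Y:Y\to V$.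 Composition, written in diagrammatic order as $f\,;\,f'$ (or $f\,;_C f'$ when along the object $C$), is by pushout; the monoidal product $\otimes$ is disjoint union (coproduct). Associators and unitors are suppressed. Monoidal tree width. Let $\mathcal A$ be the set of all morphisms (the atomic morphisms). The weight function $\nu$ is: $\nu(g)=|V|$ for a morphism $g=(X\to G\leftarrow Y)$ with $G=(V,E)$; $\nu(X)=|X|$ for composition along an object $X$; $\nu(\otimes)=0$. The set $D^{rt}_f$ of monoidal (right) tree decompositions of $f:A\to B$ is defined recursively: $(f)\in D^{rt}_f$ if $f\in\mathcal A$; $(d_1,\otimes,d_2)\in D^{rt}_f$ if $d_i\in D^{rt}_{f_i}$ and $f=f_1\otimes f_2$; $(h,;_C,d_1)\in D^{rt}_f$ if $h:A\to C$ is in $\mathcal A$, $d_1\in D^{rt}_{f_1}$ with $f_1:C\to B$, and $f=h\,;f_1$. Width: $\mathrm{wd}((f))=\nu(f)$; $\mathrm{wd}(d_1,\otimes,d_2)=\max\{\mathrm{wd}(d_1),\mathrm{wd}(d_2)\}$; $\mathrm{wd}(h,;_C,d_1)=\max\{\nu(h),\nu(C),\mathrm{wd}(d_1)\}$. Then $\mathrm{mtwd}(f)=\min_{d\in D^{rt}_f}\mathrm{wd}(d)$. *)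

theory Defs
  imports Main
begin

section \<open>Graphs\<close>

record ('v, 'e) ugraph =
  verts :: "'v set"
  edges :: "'e set"
  ends :: "'e \<Rightarrow> 'v set"

definition wf_ugraph :: "('v, 'e) ugraph \<Rightarrow> bool" where
  "wf_ugraph G \<longleftrightarrow> finite (verts G) \<and> finite (edges G) \<and>
     (\<forall>e \<in> edges G. ends G e \<subseteq> verts G \<and> card (ends G e) \<in> {1, 2})"

definition ugraph_hom ::
  "('v \<Rightarrow> 'w) \<Rightarrow> ('e \<Rightarrow> 'd) \<Rightarrow> ('v, 'e) ugraph \<Rightarrow> ('w, 'd) ugraph \<Rightarrow> bool" where
  "ugraph_hom \<alpha>V \<alpha>E G H \<longleftrightarrow> \<alpha>V ` verts G \<subseteq> verts H \<and> \<alpha>E ` edges G \<subseteq> edges H \<and>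
     (\<forall>e \<in> edges G. ends H (\<alpha>E e) = \<alpha>V ` ends G e)"

definition ugraph_iso ::
  "('v \<Rightarrow> 'w) \<Rightarrow> ('e \<Rightarrow> 'd) \<Rightarrow> ('v, 'e) ugraph \<Rightarrow> ('w, 'd) ugraph \<Rightarrow> bool" where
  "ugraph_iso \<alpha>V \<alpha>E G H \<longleftrightarrow> ugraph_hom \<alpha>V \<alpha>E G H \<and>
     bij_betw \<alpha>V (verts G) (verts H) \<and> bij_betw \<alpha>E (edges G) (edges H)"

definition discrete :: "'v set \<Rightarrow> ('v, nat) ugraph" where
  "discrete X = \<lparr>verts = X, edges = {}, ends = \<lambda>_. {}\<rparr>"


section \<open>Trees\<close>

text \<open>A walk is given by its list of vertices \<open>vs\<close> and its list of edges \<open>es\<close>, since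
  parallel edges are allowed. Loops and pairs of parallel edges count as cycles.\<close>

definition walk :: "('v, 'e) ugraph \<Rightarrow> 'v list \<Rightarrow> 'e list \<Rightarrow> bool" where
  "walk G vs es \<longleftrightarrow> length vs = Suc (length es) \<and> set vs \<subseteq> verts G \<and> set es \<subseteq> edges G \<and>
     (\<forall>i < length es. ends G (es ! i) = {vs ! i, vs ! Suc i})"

definition path :: "('v, 'e) ugraph \<Rightarrow> 'v list \<Rightarrow> 'e list \<Rightarrow> bool" where
  "path G vs es \<longleftrightarrow> walk G vs es \<and> distinct vs"

definition cycle :: "('v, 'e) ugraph \<Rightarrow> 'v list \<Rightarrow> 'e list \<Rightarrow> bool" where
  "cycle G vs es \<longleftrightarrow> walk G vs es \<and> es \<noteq> [] \<and> hd vs = last vs \<and> distinct (tl vs) \<and> distinct es"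

definition connected_graph :: "('v, 'e) ugraph \<Rightarrow> bool" where
  "connected_graph G \<longleftrightarrow> verts G \<noteq> {} \<and>
     (\<forall>u \<in> verts G. \<forall>v \<in> verts G. \<exists>vs es. path G vs es \<and> hd vs = u \<and> last vs = v)"

definition tree :: "('v, 'e) ugraph \<Rightarrow> bool" where
  "tree G \<longleftrightarrow> wf_ugraph G \<and> connected_graph G \<and> \<not> (\<exists>vs es. cycle G vs es)"


section \<open>Tree width\<close>

definition tree_decomposition ::
  "('v, 'e) ugraph \<Rightarrow> ('i, 'k) ugraph \<Rightarrow> ('i \<Rightarrow> 'v set) \<Rightarrow> bool" where
  "tree_decomposition G Y t \<longleftrightarrow> tree Y \<and>
     (\<Union>i \<in> verts Y. t i) = verts G \<and>
     (\<forall>e \<in> edges G. \<exists>i \<in> verts Y. ends G e \<subseteq> t i) \<and>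
     (\<forall>vs es. path Y vs es \<longrightarrow> (\<forall>j \<in> set vs. t (hd vs) \<inter> t (last vs) \<subseteq> t j))"

definition td_width :: "('i, 'k) ugraph \<Rightarrow> ('i \<Rightarrow> 'v set) \<Rightarrow> nat" where
  "td_width Y t = Max ((\<lambda>i. card (t i)) ` verts Y)"

text \<open>Every finite tree is isomorphic to one whose nodes and edges are natural numbers.\<close>

definition tw :: "('v, 'e) ugraph \<Rightarrow> nat" where
  "tw G = (LEAST w. \<exists>(Y :: (nat, nat) ugraph) t. tree_decomposition G Y t \<and> w = td_width Y t)"


section \<open>Cospans of graphs with discrete boundaries\<close>

text \<open>The objects are the finite sets of elements of \<open>elem\<close>, an infinite universe on which
  disjoint union is an actual operation.\<close>

datatype elem = Point nat | InL elem | InR elem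

definition osum :: "elem set \<Rightarrow> elem set \<Rightarrow> elem set" (infixr "\<oplus>\<^sub>o" 65) where
  "A \<oplus>\<^sub>o B = InL ` A \<union> InR ` B"

fun elem_case :: "(elem \<Rightarrow> 'a) \<Rightarrow> (elem \<Rightarrow> 'a) \<Rightarrow> elem \<Rightarrow> 'a" where
  "elem_case f g (InL x) = f x"
| "elem_case f g (InR x) = g x"
| "elem_case f g (Point n) = undefined"

record ('v, 'e) cospan =
  src :: "elem set"
  tgt :: "elem set"
  apex :: "('v, 'e) ugraph"
  legl :: "elem \<Rightarrow> 'v"
  legr :: "elem \<Rightarrow> 'v"

definition wf_cospan :: "('v, 'e) cospan \<Rightarrow> bool" where
  "wf_cospan f \<longleftrightarrow> finite (src f) \<and> finite (tgt f) \<and> wf_ugraph (apex f) \<and>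
     legl f ` src f \<subseteq> verts (apex f) \<and> legr f ` tgt f \<subseteq> verts (apex f)"

definition cospan_iso :: "('v, 'e) cospan \<Rightarrow> ('w, 'd) cospan \<Rightarrow> bool" where
  "cospan_iso f g \<longleftrightarrow> src f = src g \<and> tgt f = tgt g \<and>
     (\<exists>\<alpha>V \<alpha>E. ugraph_iso \<alpha>V \<alpha>E (apex f) (apex g) \<and>
        (\<forall>x \<in> src f. \<alpha>V (legl f x) = legl g x) \<and>
        (\<forall>y \<in> tgt f. \<alpha>V (legr f y) = legr g y))"

text \<open>The pushout of \<open>apex f \<leftarrow> tgt f = src g \<rightarrow> apex g\<close>: as the graph
  \<open>tgt f\<close> is discrete, only vertices are identified.\<close>

definition glue_rel ::
  "('v, 'e) cospan \<Rightarrow> ('w, 'd) cospan \<Rightarrow> (('v + 'w) \<times> ('v + 'w)) set" where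
  "glue_rel f g = (let S = (\<lambda>c. (Inl (legr f c), Inr (legl g c))) ` tgt f in (S \<union> S\<inverse>)\<^sup>*)"

definition glue :: "('v, 'e) cospan \<Rightarrow> ('w, 'd) cospan \<Rightarrow> 'v + 'w \<Rightarrow> ('v + 'w) set" where
  "glue f g x = glue_rel f g `` {x}"

definition pushout_graph ::
  "('v, 'e) cospan \<Rightarrow> ('w, 'd) cospan \<Rightarrow> (('v + 'w) set, 'e + 'd) ugraph" where
  "pushout_graph f g =
     \<lparr>verts = glue f g ` (verts (apex f) <+> verts (apex g)),
      edges = edges (apex f) <+> edges (apex g),
      ends = case_sum (\<lambda>e. (glue f g \<circ> Inl) ` ends (apex f) e)
                      (\<lambda>e. (glue f g \<circ> Inr) ` ends (apex g) e)\<rparr>"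

definition cospan_seq ::
  "('v, 'e) cospan \<Rightarrow> ('w, 'd) cospan \<Rightarrow> (('v + 'w) set, 'e + 'd) cospan" where
  "cospan_seq f g =
     \<lparr>src = src f, tgt = tgt g, apex = pushout_graph f g,
      legl = glue f g \<circ> Inl \<circ> legl f, legr = glue f g \<circ> Inr \<circ> legr g\<rparr>"

definition sum_graph ::
  "('v, 'e) ugraph \<Rightarrow> ('w, 'd) ugraph \<Rightarrow> ('v + 'w, 'e + 'd) ugraph" where
  "sum_graph G H =
     \<lparr>verts = verts G <+> verts H,
      edges = edges G <+> edges H,
      ends = case_sum (\<lambda>e. Inl ` ends G e) (\<lambda>e. Inr ` ends H e)\<rparr>"

definition cospan_par ::
  "('v, 'e) cospan \<Rightarrow> ('w, 'd) cospan \<Rightarrow> ('v + 'w, 'e + 'd) cospan" where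
  "cospan_par f g =
     \<lparr>src = src f \<oplus>\<^sub>o src g, tgt = tgt f \<oplus>\<^sub>o tgt g, apex = sum_graph (apex f) (apex g),
      legl = elem_case (Inl \<circ> legl f) (Inr \<circ> legl g),
      legr = elem_case (Inl \<circ> legr f) (Inr \<circ> legr g)\<rparr>"


section \<open>The category of isomorphism classes of cospans\<close>

text \<open>A morphism is an isomorphism class of cospans. The representatives collected in a class
  have natural numbers as vertices and edges; since apexes are finite, a cospan over any
  other types has such representatives, so \<open>cls\<close> is applicable to all cospans.\<close>

type_synonym mor = "(nat, nat) cospan set"

definition cls :: "('v, 'e) cospan \<Rightarrow> mor" where
  "cls f = {c. wf_cospan c \<and> cospan_iso f c}"

definition hom :: "elem set \<Rightarrow> elem set \<Rightarrow> mor set" where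
  "hom A B = {cls f | f :: (nat, nat) cospan. wf_cospan f \<and> src f = A \<and> tgt f = B}"

definition seq :: "mor \<Rightarrow> mor \<Rightarrow> mor" (infixl ";;" 60) where
  "F ;; G = (\<Union>f \<in> F. \<Union>g \<in> G. cls (cospan_seq f g))"

definition par :: "mor \<Rightarrow> mor \<Rightarrow> mor" (infixr "\<otimes>\<^sub>m" 70) where
  "F \<otimes>\<^sub>m G = (\<Union>f \<in> F. \<Union>g \<in> G. cls (cospan_par f g))"

definition mor_of_fun :: "elem set \<Rightarrow> elem set \<Rightarrow> (elem \<Rightarrow> elem) \<Rightarrow> mor" where
  "mor_of_fun A B \<phi> =
     cls \<lparr>src = A, tgt = B, apex = discrete B, legl = \<phi>, legr = id\<rparr>"

definition closed_mor :: "('v, 'e) ugraph \<Rightarrow> mor" where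
  "closed_mor G =
     cls \<lparr>src = {}, tgt = {}, apex = G, legl = (\<lambda>_. undefined), legr = (\<lambda>_. undefined)\<rparr>"

fun assoc_fun :: "elem \<Rightarrow> elem" where
  "assoc_fun (InL (InL x)) = InL x"
| "assoc_fun (InL (InR x)) = InR (InL x)"
| "assoc_fun (InR x) = InR (InR x)"
| "assoc_fun x = x"

fun assoc_inv_fun :: "elem \<Rightarrow> elem" where
  "assoc_inv_fun (InL x) = InL (InL x)"
| "assoc_inv_fun (InR (InL x)) = InL (InR x)"
| "assoc_inv_fun (InR (InR x)) = InR x"
| "assoc_inv_fun x = x"

text \<open>The coherence isomorphisms: everything generated from associators and unitors by
  composition and monoidal product. No symmetries are included.\<close>

inductive coherence :: "elem set \<Rightarrow> elem set \<Rightarrow> mor \<Rightarrow> bool" where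
  ident: "finite A \<Longrightarrow> coherence A A (mor_of_fun A A id)"
| assoc: "finite A \<Longrightarrow> finite B \<Longrightarrow> finite C \<Longrightarrow>
    coherence ((A \<oplus>\<^sub>o B) \<oplus>\<^sub>o C) (A \<oplus>\<^sub>o (B \<oplus>\<^sub>o C))
      (mor_of_fun ((A \<oplus>\<^sub>o B) \<oplus>\<^sub>o C) (A \<oplus>\<^sub>o (B \<oplus>\<^sub>o C)) assoc_fun)"
| assoc_inv: "finite A \<Longrightarrow> finite B \<Longrightarrow> finite C \<Longrightarrow>
    coherence (A \<oplus>\<^sub>o (B \<oplus>\<^sub>o C)) ((A \<oplus>\<^sub>o B) \<oplus>\<^sub>o C)
      (mor_of_fun (A \<oplus>\<^sub>o (B \<oplus>\<^sub>o C)) ((A \<oplus>\<^sub>o B) \<oplus>\<^sub>o C) assoc_inv_fun)"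
| unitl: "finite A \<Longrightarrow> coherence ({} \<oplus>\<^sub>o A) A (mor_of_fun ({} \<oplus>\<^sub>o A) A (elem_case id id))"
| unitl_inv: "finite A \<Longrightarrow> coherence A ({} \<oplus>\<^sub>o A) (mor_of_fun A ({} \<oplus>\<^sub>o A) InR)"
| unitr: "finite A \<Longrightarrow> coherence (A \<oplus>\<^sub>o {}) A (mor_of_fun (A \<oplus>\<^sub>o {}) A (elem_case id id))"
| unitr_inv: "finite A \<Longrightarrow> coherence A (A \<oplus>\<^sub>o {}) (mor_of_fun A (A \<oplus>\<^sub>o {}) InL)"
| comp: "coherence A B \<sigma> \<Longrightarrow> coherence B C \<tau> \<Longrightarrow> coherence A C (\<sigma> ;; \<tau>)"
| tensor: "coherence A B \<sigma> \<Longrightarrow> coherence A' B' \<tau> \<Longrightarrow>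
    coherence (A \<oplus>\<^sub>o A') (B \<oplus>\<^sub>o B') (\<sigma> \<otimes>\<^sub>m \<tau>)"


section \<open>Monoidal tree width\<close>

datatype mtree = Leaf mor | Tensor mtree mtree | Comp mor "elem set" mtree

text \<open>\<open>Drt A B F d\<close>: the term \<open>d\<close> is a monoidal (right) tree decomposition of the
  morphism \<open>F : A \<rightarrow> B\<close>. All morphisms are atomic. The suppressed associators and unitors
  are the \<open>\<sigma>\<close> and \<open>\<tau>\<close> in the case of \<open>Tensor\<close>; for \<open>Comp\<close> no such
  isomorphisms are needed, because they can be absorbed into the atomic morphism \<open>H\<close>.\<close>

inductive Drt :: "elem set \<Rightarrow> elem set \<Rightarrow> mor \<Rightarrow> mtree \<Rightarrow> bool" where
  leaf: "F \<in> hom A B \<Longrightarrow> Drt A B F (Leaf F)"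
| tensor: "Drt A1 B1 F1 d1 \<Longrightarrow> Drt A2 B2 F2 d2 \<Longrightarrow>
    coherence A (A1 \<oplus>\<^sub>o A2) \<sigma> \<Longrightarrow> coherence (B1 \<oplus>\<^sub>o B2) B \<tau> \<Longrightarrow>
    Drt A B (\<sigma> ;; (F1 \<otimes>\<^sub>m F2) ;; \<tau>) (Tensor d1 d2)"
| comp: "H \<in> hom A C \<Longrightarrow> Drt C B F1 d1 \<Longrightarrow> Drt A B (H ;; F1) (Comp H C d1)"

definition weight :: "mor \<Rightarrow> nat" where
  "weight F = card (verts (apex (SOME f. f \<in> F)))"

fun wd :: "mtree \<Rightarrow> nat" where
  "wd (Leaf F) = weight F"
| "wd (Tensor d1 d2) = max (wd d1) (wd d2)"
| "wd (Comp H C d1) = max (weight H) (max (card C) (wd d1))"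

definition mtwd :: "elem set \<Rightarrow> elem set \<Rightarrow> mor \<Rightarrow> nat" where
  "mtwd A B F = (LEAST w. \<exists>d. Drt A B F d \<and> w = wd d)"


section \<open>Soundness of the encoding\<close>

text \<open>Classes are inhabited, two cospans have the same class iff they are isomorphic, and the
  operations on classes are those on representatives.\<close>

lemma ugraph_iso_refl: "ugraph_iso id id G G"
  by (auto simp: ugraph_iso_def ugraph_hom_def)

lemma ugraph_iso_trans:
  assumes "ugraph_iso a b G H" "ugraph_iso a' b' H K"
  shows "ugraph_iso (a' \<circ> a) (b' \<circ> b) G K"
proof -
  have "bij_betw (a' \<circ> a) (verts G) (verts K)" "bij_betw (b' \<circ> b) (edges G) (edges K)"
    using assms by (auto simp: ugraph_iso_def intro: bij_betw_trans)
  moreover have "b e \<in> edges H" if "e \<in> edges G" for e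
    using assms that by (auto simp: ugraph_iso_def ugraph_hom_def)
  then have "ends K ((b' \<circ> b) e) = (a' \<circ> a) ` ends G e" if "e \<in> edges G" for e
    using assms that by (simp add: ugraph_iso_def ugraph_hom_def image_comp)
  ultimately show ?thesis
    by (simp add: ugraph_iso_def ugraph_hom_def bij_betw_def)
qed

lemma ugraph_iso_sym:
  assumes "wf_ugraph G" "ugraph_iso a b G H"
  shows "ugraph_iso (the_inv_into (verts G) a) (the_inv_into (edges G) b) H G"
proof -
  have a: "bij_betw a (verts G) (verts H)" and b: "bij_betw b (edges G) (edges H)"
    and e: "\<And>e. e \<in> edges G \<Longrightarrow> ends H (b e) = a ` ends G e"
    using assms(2) by (auto simp: ugraph_iso_def ugraph_hom_def)
  have a': "bij_betw (the_inv_into (verts G) a) (verts H) (verts G)"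
    and b': "bij_betw (the_inv_into (edges G) b) (edges H) (edges G)"
    using a b by (auto intro: bij_betw_the_inv_into)
  have "ends G (the_inv_into (edges G) b d) = the_inv_into (verts G) a ` ends H d"
    if d: "d \<in> edges H" for d
  proof -
    obtain e where e': "e \<in> edges G" "d = b e"
      using b d by (auto simp: bij_betw_def)
    have "ends G e \<subseteq> verts G"
      using assms(1) e' by (auto simp: wf_ugraph_def)
    then have "the_inv_into (verts G) a ` a ` ends G e = ends G e"
      using a by (force simp: bij_betw_def the_inv_into_f_f image_iff)
    then show ?thesis
      using e e' b by (simp add: bij_betw_def the_inv_into_f_f)
  qed
  then show ?thesis
    using a' b' by (auto simp: ugraph_iso_def ugraph_hom_def bij_betw_def)
qed

lemma cospan_iso_refl: "cospan_iso f f"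
  unfolding cospan_iso_def using ugraph_iso_refl by fastforce

lemma cospan_iso_trans:
  assumes "cospan_iso f g" "cospan_iso g h"
  shows "cospan_iso f h"
proof -
  obtain a b where 1: "ugraph_iso a b (apex f) (apex g)"
    "\<forall>x \<in> src f. a (legl f x) = legl g x" "\<forall>y \<in> tgt f. a (legr f y) = legr g y"
    using assms(1) by (auto simp: cospan_iso_def)
  obtain a' b' where 2: "ugraph_iso a' b' (apex g) (apex h)"
    "\<forall>x \<in> src g. a' (legl g x) = legl h x" "\<forall>y \<in> tgt g. a' (legr g y) = legr h y"
    using assms(2) by (auto simp: cospan_iso_def)
  show ?thesis
    unfolding cospan_iso_def using assms 1 2 ugraph_iso_trans[OF 1(1) 2(1)]
    by (intro conjI exI[of _ "a' \<circ> a"] exI[of _ "b' \<circ> b"]) (auto simp: cospan_iso_def)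
qed

lemma cospan_iso_sym:
  assumes "wf_cospan f" "cospan_iso f g"
  shows "cospan_iso g f"
proof -
  obtain a b where 1: "ugraph_iso a b (apex f) (apex g)"
    "\<forall>x \<in> src f. a (legl f x) = legl g x" "\<forall>y \<in> tgt f. a (legr f y) = legr g y"
    using assms(2) by (auto simp: cospan_iso_def)
  have inj: "inj_on a (verts (apex f))"
    using 1(1) by (auto simp: ugraph_iso_def bij_betw_def)
  have inv: "the_inv_into (verts (apex f)) a (a v) = v" if "v \<in> verts (apex f)" for v
    using inj that by (rule the_inv_into_f_f)
  show ?thesis
    unfolding cospan_iso_def
  proof (intro conjI exI)
    show "src g = src f" "tgt g = tgt f"
      using assms(2) by (auto simp: cospan_iso_def)
    show "ugraph_iso (the_inv_into (verts (apex f)) a) (the_inv_into (edges (apex f)) b)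
      (apex g) (apex f)"
      using assms(1) 1(1) by (intro ugraph_iso_sym) (auto simp: wf_cospan_def)
    show "\<forall>x \<in> src g. the_inv_into (verts (apex f)) a (legl g x) = legl f x"
    proof
      fix x assume "x \<in> src g"
      then have x: "x \<in> src f" using assms(2) by (simp add: cospan_iso_def)
      then have "legl f x \<in> verts (apex f)" using assms(1) by (auto simp: wf_cospan_def)
      from inv[OF this] 1(2) x show "the_inv_into (verts (apex f)) a (legl g x) = legl f x"
        by simp
    qed
    show "\<forall>x \<in> tgt g. the_inv_into (verts (apex f)) a (legr g x) = legr f x"
    proof
      fix x assume "x \<in> tgt g"
      then have x: "x \<in> tgt f" using assms(2) by (simp add: cospan_iso_def)
      then have "legr f x \<in> verts (apex f)" using assms(1) by (auto simp: wf_cospan_def)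
      from inv[OF this] 1(3) x show "the_inv_into (verts (apex f)) a (legr g x) = legr f x"
        by simp
    qed
  qed
qed

lemma card_image_12:
  assumes "card S \<in> {1, 2}"
  shows "card (h ` S) \<in> {1, 2}"
proof -
  have S: "finite S" "S \<noteq> {}" using assms by (auto intro: card_ge_0_finite)
  then have "card (h ` S) \<le> card S" "card (h ` S) \<noteq> 0" by (simp_all add: card_image_le)
  then show ?thesis using assms by auto
qed

lemma cls_nonempty:
  assumes "wf_cospan f"
  shows "cls f \<noteq> {}"
proof -
  let ?V = "verts (apex f)" and ?E = "edges (apex f)"
  have fin: "finite ?V" "finite ?E" using assms by (auto simp: wf_cospan_def wf_ugraph_def)
  obtain a :: "'a \<Rightarrow> nat" where a: "inj_on a ?V" using fin finite_imp_inj_to_nat_seg by metis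
  obtain b :: "'b \<Rightarrow> nat" where b: "inj_on b ?E" using fin finite_imp_inj_to_nat_seg by metis
  define G where "G = \<lparr>verts = a ` ?V, edges = b ` ?E,
     ends = (\<lambda>d. a ` ends (apex f) (the_inv_into ?E b d))\<rparr>"
  define c where "c = \<lparr>src = src f, tgt = tgt f, apex = G, legl = a \<circ> legl f, legr = a \<circ> legr f\<rparr>"
  have ends: "ends G (b e) \<subseteq> verts G \<and> card (ends G (b e)) \<in> {1, 2}" if e: "e \<in> ?E" for e
  proof -
    have sub: "ends (apex f) e \<subseteq> ?V" and c2: "card (ends (apex f) e) \<in> {1, 2}"
      using assms e unfolding wf_cospan_def wf_ugraph_def by blast+
    have "ends G (b e) = a ` ends (apex f) e"
      using the_inv_into_f_f[OF b e] by (simp add: G_def)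
    then show ?thesis
      using sub card_image_12[OF c2, of a] by (auto simp: G_def)
  qed
  have "wf_ugraph G"
    unfolding wf_ugraph_def
  proof (intro conjI ballI)
    show "finite (verts G)" "finite (edges G)" using fin by (simp_all add: G_def)
    fix d assume "d \<in> edges G"
    then obtain e where e: "e \<in> ?E" "d = b e" by (auto simp: G_def)
    show "ends G d \<subseteq> verts G" "card (ends G d) \<in> {1, 2}"
      using ends[OF e(1)] e(2) by simp_all
  qed
  moreover have "finite (src f)" "finite (tgt f)" "legl f ` src f \<subseteq> ?V" "legr f ` tgt f \<subseteq> ?V"
    using assms by (simp_all add: wf_cospan_def)
  ultimately have "wf_cospan c" by (auto simp: wf_cospan_def c_def G_def)
  moreover have "ugraph_iso a b (apex f) G"
    using a b by (auto simp: ugraph_iso_def ugraph_hom_def G_def bij_betw_def the_inv_into_f_f)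
  then have "cospan_iso f c" by (auto simp: cospan_iso_def c_def)
  ultimately show ?thesis by (auto simp: cls_def)
qed

lemma cls_eqI:
  assumes "wf_cospan f" "cospan_iso f g"
  shows "cls f = cls g"
  using assms cospan_iso_sym[OF assms] unfolding cls_def by (auto intro: cospan_iso_trans)

lemma cls_eq_iff:
  assumes "wf_cospan f" "wf_cospan g"
  shows "cls f = cls g \<longleftrightarrow> cospan_iso f g"
proof
  assume eq: "cls f = cls g"
  obtain c where "c \<in> cls f" using cls_nonempty[OF assms(1)] by blast
  then have "cospan_iso f c" "cospan_iso g c" using eq by (auto simp: cls_def)
  then show "cospan_iso f g" using cospan_iso_sym[OF assms(2)] cospan_iso_trans by blast
qed (use assms cls_eqI in blast)

lemma weight_cls:
  assumes "wf_cospan f"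
  shows "weight (cls f) = card (verts (apex f))"
proof -
  have "(SOME c. c \<in> cls f) \<in> cls f" using cls_nonempty[OF assms] some_in_eq by blast
  then obtain a where "bij_betw a (verts (apex f)) (verts (apex (SOME c. c \<in> cls f)))"
    unfolding cls_def cospan_iso_def ugraph_iso_def by blast
  then show ?thesis by (simp add: weight_def bij_betw_same_card)
qed

lemma glue_rel_equiv: "equiv UNIV (glue_rel f g)"
  unfolding glue_rel_def Let_def
  by (intro equivI) (auto simp: refl_on_def trans_rtrancl sym_rtrancl sym_Un_converse)

lemma glue_eq_iff: "glue f g x = glue f g y \<longleftrightarrow> (x, y) \<in> glue_rel f g"
  unfolding glue_def using glue_rel_equiv by (metis UNIV_I eq_equiv_class_iff)

lemma glue_legs: "c \<in> tgt f \<Longrightarrow> glue f g (Inl (legr f c)) = glue f g (Inr (legl g c))"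
  by (auto simp: glue_eq_iff glue_rel_def Let_def)

lemma glue_rel_respects:
  assumes "\<And>c. c \<in> tgt f \<Longrightarrow> p (legr f c) = q (legl g c)" "(x, y) \<in> glue_rel f g"
  shows "case_sum p q x = case_sum p q y"
  using assms(2) unfolding glue_rel_def Let_def
  by (induction rule: rtrancl_induct) (auto simp: assms(1))

lemma wf_pushout_graph:
  assumes "wf_ugraph (apex f)" "wf_ugraph (apex g)"
  shows "wf_ugraph (pushout_graph f g)"
  unfolding wf_ugraph_def
proof (intro conjI ballI)
  show "finite (verts (pushout_graph f g))" "finite (edges (pushout_graph f g))"
    using assms by (simp_all add: wf_ugraph_def pushout_graph_def)
next
  fix e assume "e \<in> edges (pushout_graph f g)"
  then consider d where "e = Inl d" "d \<in> edges (apex f)" | d where "e = Inr d" "d \<in> edges (apex g)"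
    by (auto simp: pushout_graph_def)
  then have "ends (pushout_graph f g) e \<subseteq> verts (pushout_graph f g) \<and>
    card (ends (pushout_graph f g) e) \<in> {1, 2}"
  proof cases
    case 1
    then have "ends (apex f) d \<subseteq> verts (apex f)" "card (ends (apex f) d) \<in> {1, 2}"
      using assms(1) unfolding wf_ugraph_def by blast+
    then show ?thesis
      using 1 card_image_12[of "ends (apex f) d" "glue f g \<circ> Inl"] by (auto simp: pushout_graph_def)
  next
    case 2
    then have "ends (apex g) d \<subseteq> verts (apex g)" "card (ends (apex g) d) \<in> {1, 2}"
      using assms(2) unfolding wf_ugraph_def by blast+
    then show ?thesis
      using 2 card_image_12[of "ends (apex g) d" "glue f g \<circ> Inr"] by (auto simp: pushout_graph_def)
  qed
  then show "ends (pushout_graph f g) e \<subseteq> verts (pushout_graph f g)"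
    "card (ends (pushout_graph f g) e) \<in> {1, 2}" by blast+
qed

lemma wf_cospan_seq:
  assumes "wf_cospan f" "wf_cospan g"
  shows "wf_cospan (cospan_seq f g)"
proof -
  have "legl f ` src f \<subseteq> verts (apex f)" "legr g ` tgt g \<subseteq> verts (apex g)"
    using assms by (simp_all add: wf_cospan_def)
  moreover have "wf_ugraph (pushout_graph f g)" "finite (src f)" "finite (tgt g)"
    using assms by (simp_all add: wf_cospan_def wf_pushout_graph)
  ultimately show ?thesis
    by (auto simp: wf_cospan_def cospan_seq_def pushout_graph_def)
qed

text \<open>The graph \<open>pushout_graph f g\<close> has the universal property of the pushout.\<close>

lemma pushout_hom:
  "ugraph_hom (glue f g \<circ> Inl) Inl (apex f) (pushout_graph f g)"
  "ugraph_hom (glue f g \<circ> Inr) Inr (apex g) (pushout_graph f g)"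
  by (auto simp: ugraph_hom_def pushout_graph_def)

lemma pushout_universal:
  assumes f: "ugraph_hom pV pE (apex f) K" and g: "ugraph_hom qV qE (apex g) K"
    and comm: "\<And>c. c \<in> tgt f \<Longrightarrow> pV (legr f c) = qV (legl g c)"
  shows "\<exists>uV uE. ugraph_hom uV uE (pushout_graph f g) K \<and>
    (\<forall>v. uV (glue f g (Inl v)) = pV v) \<and> (\<forall>w. uV (glue f g (Inr w)) = qV w) \<and>
    (\<forall>e. uE (Inl e) = pE e) \<and> (\<forall>e. uE (Inr e) = qE e)"
proof -
  define uV where "uV X = case_sum pV qV (SOME x. glue f g x = X)" for X
  have u: "uV (glue f g x) = case_sum pV qV x" for x
  proof -
    have "glue f g (SOME y. glue f g y = glue f g x) = glue f g x" by (rule someI) (rule refl)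
    then have "(SOME y. glue f g y = glue f g x, x) \<in> glue_rel f g"
      by (simp add: glue_eq_iff)
    then show ?thesis unfolding uV_def using glue_rel_respects[of f pV qV g] comm by blast
  qed
  have "ugraph_hom uV (case_sum pE qE) (pushout_graph f g) K"
    using f g by (auto simp: ugraph_hom_def pushout_graph_def u image_comp comp_def)
  then show ?thesis using u by (intro exI[of _ uV] exI[of _ "case_sum pE qE"]) auto
qed

lemma bij_betw_map_sum:
  assumes "bij_betw h A A'" "bij_betw k B B'"
  shows "bij_betw (map_sum h k) (A <+> B) (A' <+> B')"
proof -
  have "map_sum h k ` (A <+> B) = h ` A <+> k ` B"
    by (simp add: Plus_def image_Un image_image)
  moreover have "inj_on (map_sum h k) (A <+> B)"
    using assms by (auto simp: bij_betw_def intro!: inj_onI elim!: PlusE dest: inj_onD)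
  ultimately show ?thesis
    using assms by (simp add: bij_betw_def)
qed

lemma cospan_seq_iso:
  fixes f :: "('a, 'b) cospan" and g :: "('c, 'd) cospan"
    and f' :: "('e, 'f) cospan" and g' :: "('g, 'h) cospan"
  assumes wf: "wf_cospan f" "wf_cospan g" "wf_cospan f'" "wf_cospan g'"
    and comp: "tgt f = src g" and iso: "cospan_iso f f'" "cospan_iso g g'"
  shows "cospan_iso (cospan_seq f g) (cospan_seq f' g')"
proof -
  obtain a b where f: "ugraph_iso a b (apex f) (apex f')"
    "\<And>x. x \<in> src f \<Longrightarrow> a (legl f x) = legl f' x" "\<And>y. y \<in> tgt f \<Longrightarrow> a (legr f y) = legr f' y"
    using iso(1) unfolding cospan_iso_def by blast
  obtain a' b' where g: "ugraph_iso a' b' (apex g) (apex g')"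
    "\<And>x. x \<in> src g \<Longrightarrow> a' (legl g x) = legl g' x" "\<And>y. y \<in> tgt g \<Longrightarrow> a' (legr g y) = legr g' y"
    using iso(2) unfolding cospan_iso_def by blast
  have st: "src f' = src f" "tgt f' = tgt f" "src g' = src g" "tgt g' = tgt g"
    using iso by (auto simp: cospan_iso_def)
  let ?V = "verts (apex f) <+> verts (apex g)" and ?V' = "verts (apex f') <+> verts (apex g')"
  define m where "m = map_sum a a'"
  define s where "s = (\<lambda>c. (Inl (legr f c) :: 'a + 'c, Inr (legl g c) :: 'a + 'c)) ` tgt f"
  define s' where "s' = (\<lambda>c. (Inl (legr f' c) :: 'e + 'g, Inr (legl g' c) :: 'e + 'g)) ` tgt f"
  have r: "glue_rel f g = (s \<union> s\<inverse>)\<^sup>*" and r': "glue_rel f' g' = (s' \<union> s'\<inverse>)\<^sup>*"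
    unfolding glue_rel_def Let_def s_def s'_def st by (rule refl)+
  have bm: "bij_betw m ?V ?V'"
    using f(1) g(1) unfolding ugraph_iso_def m_def by (intro bij_betw_map_sum) blast+
  have sV: "s \<subseteq> ?V \<times> ?V" using wf comp unfolding s_def wf_cospan_def by auto
  have s'V: "s' \<subseteq> ?V' \<times> ?V'" using wf comp st unfolding s'_def wf_cospan_def by auto
  have s': "s' = map_prod m m ` s"
    unfolding s_def s'_def m_def image_image using f(3) g(2) comp by (intro image_cong) auto
  have fw: "(m x, m y) \<in> glue_rel f' g'" if "(x, y) \<in> glue_rel f g" for x y
    using that unfolding r r'
  proof (induction rule: rtrancl_induct)
    case (step y z)
    then have "(m y, m z) \<in> s' \<union> s'\<inverse>"
      unfolding s' by (auto intro: rev_image_eqI)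
    with step show ?case by (meson rtrancl.rtrancl_into_rtrancl)
  qed simp
  have bw: "\<exists>y \<in> ?V. z = m y \<and> (x, y) \<in> glue_rel f g"
    if "(m x, z) \<in> glue_rel f' g'" "x \<in> ?V" for x z
    using that(1) unfolding r r'
  proof (induction rule: rtrancl_induct)
    case (step z w)
    then obtain y where y: "y \<in> ?V" "z = m y" "(x, y) \<in> (s \<union> s\<inverse>)\<^sup>*" by blast
    obtain y1 w1 where w1: "z = m y1" "w = m w1" "(y1, w1) \<in> s \<union> s\<inverse>"
      using step(2) unfolding s' by (elim UnE converseE imageE) auto
    have "y1 \<in> ?V" "w1 \<in> ?V" using w1(3) sV by auto
    then have "y1 = y" using bm y w1 by (auto simp: bij_betw_def dest: inj_onD)
    then have "(x, w1) \<in> (s \<union> s\<inverse>)\<^sup>*" using y(3) w1(3) by (auto intro: rtrancl_into_rtrancl)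
    then show ?case using w1(2) \<open>w1 \<in> ?V\<close> by blast
  qed (use that in auto)
  have eq: "glue f' g' (m x) = glue f' g' (m y) \<longleftrightarrow> glue f g x = glue f g y"
    if xy: "x \<in> ?V" "y \<in> ?V" for x y
  proof
    assume "glue f' g' (m x) = glue f' g' (m y)"
    then obtain y' where "y' \<in> ?V" "m y = m y'" "(x, y') \<in> glue_rel f g"
      using bw[OF _ xy(1)] unfolding glue_eq_iff by blast
    moreover from this have "y = y'" using bm xy by (auto simp: bij_betw_def dest: inj_onD)
    ultimately show "glue f g x = glue f g y" by (simp add: glue_eq_iff)
  qed (auto simp: glue_eq_iff fw)
  define u where "u X = glue f' g' (m (SOME x. x \<in> ?V \<and> glue f g x = X))" for X
  have u: "u (glue f g x) = glue f' g' (m x)" if "x \<in> ?V" for x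
  proof -
    let ?y = "SOME y. y \<in> ?V \<and> glue f g y = glue f g x"
    have "?y \<in> ?V \<and> glue f g ?y = glue f g x"
      by (rule someI[where x = x]) (simp only: that simp_thms)
    then have "glue f' g' (m ?y) = glue f' g' (m x)" using eq[of ?y x] that by simp
    then show ?thesis by (simp only: u_def)
  qed
  have uP: "u (glue f g (Inl v)) = glue f' g' (Inl (a v))" if "v \<in> verts (apex f)" for v
    using u[of "Inl v"] that by (auto simp: m_def)
  have uQ: "u (glue f g (Inr v)) = glue f' g' (Inr (a' v))" if "v \<in> verts (apex g)" for v
    using u[of "Inr v"] that by (auto simp: m_def)
  have bV: "bij_betw u (glue f g ` ?V) (glue f' g' ` ?V')"
    unfolding bij_betw_def
  proof
    show "inj_on u (glue f g ` ?V)"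
    proof (rule inj_onI)
      fix X Y assume "X \<in> glue f g ` ?V" "Y \<in> glue f g ` ?V" and uXY: "u X = u Y"
      then obtain x y where xy: "x \<in> ?V" "X = glue f g x" "y \<in> ?V" "Y = glue f g y"
        by (elim imageE) blast
      then have "glue f' g' (m x) = glue f' g' (m y)" using uXY u by metis
      then show "X = Y" using eq[OF xy(1,3)] xy(2,4) by simp
    qed
    have "u ` glue f g ` ?V = glue f' g' ` m ` ?V"
      unfolding image_image using u by (intro image_cong) blast+
    then show "u ` glue f g ` ?V = glue f' g' ` ?V'" using bm by (simp add: bij_betw_def)
  qed
  have bE: "bij_betw (map_sum b b') (edges (apex f) <+> edges (apex g))
     (edges (apex f') <+> edges (apex g'))"
    using f(1) g(1) unfolding ugraph_iso_def by (intro bij_betw_map_sum) blast+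
  have ef: "ends (apex f) e \<subseteq> verts (apex f)" "ends (apex f') (b e) = a ` ends (apex f) e"
    if "e \<in> edges (apex f)" for e
    using that wf f(1) by (auto simp: wf_cospan_def wf_ugraph_def ugraph_iso_def ugraph_hom_def)
  have eg: "ends (apex g) e \<subseteq> verts (apex g)" "ends (apex g') (b' e) = a' ` ends (apex g) e"
    if "e \<in> edges (apex g)" for e
    using that wf g(1) by (auto simp: wf_cospan_def wf_ugraph_def ugraph_iso_def ugraph_hom_def)
  have en: "ends (pushout_graph f' g') (map_sum b b' e) = u ` ends (pushout_graph f g) e"
    if e: "e \<in> edges (apex f) <+> edges (apex g)" for e
  proof (cases e)
    case (Inl d)
    then have d: "d \<in> edges (apex f)" using e by auto
    have "u ` (glue f g \<circ> Inl) ` ends (apex f) d = (glue f' g' \<circ> Inl) ` a ` ends (apex f) d"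
      unfolding image_comp using ef[OF d] uP by (intro image_cong) auto
    then show ?thesis using Inl ef[OF d] by (simp add: pushout_graph_def)
  next
    case (Inr d)
    then have d: "d \<in> edges (apex g)" using e by auto
    have "u ` (glue f g \<circ> Inr) ` ends (apex g) d = (glue f' g' \<circ> Inr) ` a' ` ends (apex g) d"
      unfolding image_comp using eg[OF d] uQ by (intro image_cong) auto
    then show ?thesis using Inr eg[OF d] by (simp add: pushout_graph_def)
  qed
  have "ugraph_iso u (map_sum b b') (pushout_graph f g) (pushout_graph f' g')"
    unfolding ugraph_iso_def ugraph_hom_def
  proof (intro conjI ballI)
    show bV': "bij_betw u (verts (pushout_graph f g)) (verts (pushout_graph f' g'))"
      using bV by (simp add: pushout_graph_def)
    show bE': "bij_betw (map_sum b b') (edges (pushout_graph f g)) (edges (pushout_graph f' g'))"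
      using bE by (simp add: pushout_graph_def)
    show "u ` verts (pushout_graph f g) \<subseteq> verts (pushout_graph f' g')"
      "map_sum b b' ` edges (pushout_graph f g) \<subseteq> edges (pushout_graph f' g')"
      using bij_betw_imp_surj_on[OF bV'] bij_betw_imp_surj_on[OF bE'] by blast+
    fix e assume "e \<in> edges (pushout_graph f g)"
    then show "ends (pushout_graph f' g') (map_sum b b' e) = u ` ends (pushout_graph f g) e"
      using en by (simp add: pushout_graph_def)
  qed
  moreover have "u (glue f g (Inl (legl f x))) = glue f' g' (Inl (legl f' x))" if "x \<in> src f" for x
    using that wf(1) f(2) uP[of "legl f x"] by (auto simp: wf_cospan_def)
  moreover have "u (glue f g (Inr (legr g x))) = glue f' g' (Inr (legr g' x))" if "x \<in> tgt g" for x
    using that wf(2) g(3) uQ[of "legr g x"] by (auto simp: wf_cospan_def)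
  ultimately show ?thesis
    unfolding cospan_iso_def using st
    by (intro conjI exI[of _ u] exI[of _ "map_sum b b'"]) (simp_all add: cospan_seq_def)
qed

lemma seq_cls:
  assumes "wf_cospan f" "wf_cospan g" "tgt f = src g"
  shows "cls f ;; cls g = cls (cospan_seq f g)"
proof -
  have "cls (cospan_seq f' g') = cls (cospan_seq f g)" if "f' \<in> cls f" "g' \<in> cls g" for f' g'
    using that assms cospan_seq_iso[of f g f' g'] wf_cospan_seq[of f g]
    by (intro cls_eqI[symmetric]) (auto simp: cls_def)
  then show ?thesis
    unfolding seq_def using cls_nonempty[OF assms(1)] cls_nonempty[OF assms(2)] by blast
qed

lemma wf_sum_graph:
  assumes "wf_ugraph G" "wf_ugraph H"
  shows "wf_ugraph (sum_graph G H)"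
  unfolding wf_ugraph_def
proof (intro conjI ballI)
  show "finite (verts (sum_graph G H))" "finite (edges (sum_graph G H))"
    using assms by (simp_all add: wf_ugraph_def sum_graph_def)
next
  fix e assume "e \<in> edges (sum_graph G H)"
  then consider d where "e = Inl d" "d \<in> edges G" | d where "e = Inr d" "d \<in> edges H"
    by (auto simp: sum_graph_def)
  then have "ends (sum_graph G H) e \<subseteq> verts (sum_graph G H) \<and>
    card (ends (sum_graph G H) e) \<in> {1, 2}"
  proof cases
    case 1
    then have "ends G d \<subseteq> verts G" "card (ends G d) \<in> {1, 2}"
      using assms(1) unfolding wf_ugraph_def by blast+
    then show ?thesis
      using 1 card_image_12[of "ends G d" Inl] by (auto simp: sum_graph_def)
  next
    case 2
    then have "ends H d \<subseteq> verts H" "card (ends H d) \<in> {1, 2}"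
      using assms(2) unfolding wf_ugraph_def by blast+
    then show ?thesis
      using 2 card_image_12[of "ends H d" Inr] by (auto simp: sum_graph_def)
  qed
  then show "ends (sum_graph G H) e \<subseteq> verts (sum_graph G H)"
    "card (ends (sum_graph G H) e) \<in> {1, 2}" by blast+
qed

lemma wf_cospan_par:
  assumes "wf_cospan f" "wf_cospan g"
  shows "wf_cospan (cospan_par f g)"
proof -
  have "legl f ` src f \<subseteq> verts (apex f)" "legr f ` tgt f \<subseteq> verts (apex f)"
    "legl g ` src g \<subseteq> verts (apex g)" "legr g ` tgt g \<subseteq> verts (apex g)"
    using assms by (simp_all add: wf_cospan_def)
  moreover have "wf_ugraph (sum_graph (apex f) (apex g))"
    using assms by (simp add: wf_cospan_def wf_sum_graph)
  moreover have "finite (src f)" "finite (tgt f)" "finite (src g)" "finite (tgt g)"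
    using assms by (simp_all add: wf_cospan_def)
  ultimately show ?thesis
    by (auto simp: wf_cospan_def cospan_par_def sum_graph_def osum_def)
qed

lemma cospan_par_iso:
  assumes "cospan_iso f f'" "cospan_iso g g'"
  shows "cospan_iso (cospan_par f g) (cospan_par f' g')"
proof -
  obtain a b where f: "ugraph_iso a b (apex f) (apex f')"
    "\<And>x. x \<in> src f \<Longrightarrow> a (legl f x) = legl f' x" "\<And>y. y \<in> tgt f \<Longrightarrow> a (legr f y) = legr f' y"
    using assms(1) unfolding cospan_iso_def by blast
  obtain a' b' where g: "ugraph_iso a' b' (apex g) (apex g')"
    "\<And>x. x \<in> src g \<Longrightarrow> a' (legl g x) = legl g' x" "\<And>y. y \<in> tgt g \<Longrightarrow> a' (legr g y) = legr g' y"
    using assms(2) unfolding cospan_iso_def by blast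
  have "ugraph_hom (map_sum a a') (map_sum b b') (sum_graph (apex f) (apex g))
      (sum_graph (apex f') (apex g'))"
    using f(1) g(1)
    by (auto simp: ugraph_iso_def ugraph_hom_def sum_graph_def image_image)
  then have "ugraph_iso (map_sum a a') (map_sum b b') (sum_graph (apex f) (apex g))
      (sum_graph (apex f') (apex g'))"
    using f(1) g(1) by (simp add: ugraph_iso_def sum_graph_def bij_betw_map_sum)
  then show ?thesis
    unfolding cospan_iso_def using assms f g
    by (intro conjI exI[of _ "map_sum a a'"] exI[of _ "map_sum b b'"])
       (auto simp: cospan_par_def osum_def cospan_iso_def)
qed

lemma par_cls:
  assumes "wf_cospan f" "wf_cospan g"
  shows "cls f \<otimes>\<^sub>m cls g = cls (cospan_par f g)"
proof -
  have "cls (cospan_par f' g') = cls (cospan_par f g)" if "f' \<in> cls f" "g' \<in> cls g" for f' g'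
    using that cospan_par_iso[of f f' g g'] wf_cospan_par[OF assms]
    by (intro cls_eqI[symmetric]) (auto simp: cls_def)
  then show ?thesis
    unfolding par_def using cls_nonempty[OF assms(1)] cls_nonempty[OF assms(2)] by blast
qed

lemma closed_mor_hom:
  assumes "wf_ugraph G"
  shows "closed_mor G \<in> hom {} {}"
proof -
  let ?g = "\<lparr>src = {}, tgt = {}, apex = G, legl = (\<lambda>_. undefined), legr = (\<lambda>_. undefined)\<rparr>"
  have wf: "wf_cospan ?g" using assms by (simp add: wf_cospan_def)
  obtain c where c: "c \<in> cls ?g" using cls_nonempty[OF wf] by blast
  then have c': "wf_cospan c" "cospan_iso ?g c" by (simp_all add: cls_def)
  have "closed_mor G = cls c" unfolding closed_mor_def using cls_eqI[OF wf c'(2)] .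
  then show ?thesis using c' by (auto simp: hom_def cospan_iso_def)
qed

end

theory Submission
  imports Defs
begin

text \<open>Both inequalities pass through rooted tree decompositions, generated by three operations:
  a single bag, joining two decompositions with the same root bag, and attaching a new root.
  In a monoidal decomposition of \<open>f : A \<rightarrow> B\<close> only the left boundary matters: by
  induction, the apex of \<open>f\<close> has a decomposition rooted at the image of \<open>A\<close>, of width
  at most \<open>max (wd d) (card A)\<close>. A composition along \<open>C\<close> collapses only vertices in the
  image of \<open>C\<close>, which lie in one bag, and charges \<open>card C\<close>; at a tensor the root is the
  union of the two boundaries. Conversely, joining two decompositions at a bag \<open>R\<close> is the composite
  of the discrete graph \<open>R\<close> with a tensor along two copies of \<open>R\<close>; this is the only
  place where the factor 2 arises.\<close>

section \<open>Rooted tree decompositions\<close>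

text \<open>The legs of a cospan need not be injective, so a pushout may identify vertices inside
  one of the two apexes, and a decomposition of a composite is more than a union of two. Such a
  quotient is harmless if all vertices to be identified share a bag; this is why a root bag is
  prescribed throughout. A tensor has weight 0, yet joining the decompositions of its factors needs
  a bag containing both left boundaries, of size \<open>card A1 + card A2 = card A\<close>. Below a
  composition along \<open>C\<close> this is at most \<open>card C\<close>, which that composition
  has charged; with no composition above, it is 0 because the morphism of a graph has empty source.
  Hence the summand-free bound with \<open>card A\<close>, and no factor in the lower bound. In the
  other direction every atomic morphism used has at most \<open>k\<close> vertices. Only an object
  can exceed \<open>k\<close>: one vertex of a discrete graph may be hit by several boundary
  points.\<close>

text \<open>In \<open>rooted_td k en V E R\<close> the edge sets may overlap in \<open>join\<close>, so that \<open>E\<close> may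
  consist of all edges that fit into some bag; an edge is assigned to one side only in
  \<open>Drt_exists\<close>.\<close>

inductive rooted_td :: "nat \<Rightarrow> ('e \<Rightarrow> 'v set) \<Rightarrow> 'v set \<Rightarrow> 'e set \<Rightarrow> 'v set \<Rightarrow> bool"
  for k en where
  bag: "finite R \<Longrightarrow> card R \<le> k \<Longrightarrow> \<forall>e \<in> E. en e \<subseteq> R \<Longrightarrow> rooted_td k en R E R"
| join: "rooted_td k en V1 E1 R \<Longrightarrow> rooted_td k en V2 E2 R \<Longrightarrow> V1 \<inter> V2 = R \<Longrightarrow>
    rooted_td k en (V1 \<union> V2) (E1 \<union> E2) R"
| reroot: "rooted_td k en V E R \<Longrightarrow> finite R' \<Longrightarrow> card R' \<le> k \<Longrightarrow> R' \<inter> V \<subseteq> R \<Longrightarrow>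
    \<forall>e \<in> E'. en e \<subseteq> R' \<Longrightarrow> rooted_td k en (V \<union> R') (E \<union> E') R'"

lemma rooted_td_root:
  assumes "rooted_td k en V E R"
  shows "finite R" "card R \<le> k" "R \<subseteq> V"
  using assms by (induction rule: rooted_td.induct) auto

lemma rooted_td_ends: "rooted_td k en V E R \<Longrightarrow> e \<in> E \<Longrightarrow> en e \<subseteq> V"
  by (induction rule: rooted_td.induct) blast+

lemma rooted_td_finite: "rooted_td k en V E R \<Longrightarrow> finite V"
  by (induction rule: rooted_td.induct) auto

lemma rooted_td_mono:
  assumes "rooted_td k en V E R" "k \<le> k'"
  shows "rooted_td k' en V E R"
  using assms(1)
proof (induction rule: rooted_td.induct)
  case bag
  then show ?case using assms(2) by (intro rooted_td.bag) auto
next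
  case join
  then show ?case by (intro rooted_td.join)
next
  case (reroot V E R)
  then show ?case using assms(2) by (intro rooted_td.reroot[of _ _ _ _ R]) auto
qed

text \<open>No bag is shrunk: a further node with bag \<open>R'\<close> is put above the old root,
  so \<open>V\<close> and \<open>E\<close> stay as they are.\<close>

lemma rooted_td_subset:
  assumes "rooted_td k en V E R" "R' \<subseteq> R"
  shows "rooted_td k en V E R'"
proof -
  have "finite R'" "card R' \<le> k" "R' \<subseteq> V"
    using rooted_td_root[OF assms(1)] assms(2)
    by (blast intro: finite_subset, metis card_mono le_trans, blast)
  then show ?thesis
    using rooted_td.reroot[OF assms(1), of R' "{}"] assms(2) by (auto simp: Un_absorb2)
qed

text \<open>Isomorphisms, sum injections and maps into a pushout are all instances; for the last,
  \<open>\<phi>\<close> must be allowed to collapse the root. Images of bags do not grow, and any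
  new overlap between two pieces comes from identified vertices, which share the root bag.\<close>

lemma rooted_td_image:
  assumes "rooted_td k en V E R"
    and "\<And>e. e \<in> E \<Longrightarrow> en' (g e) = \<phi> ` en e"
    and "\<And>x y. x \<in> V \<Longrightarrow> y \<in> V \<Longrightarrow> \<phi> x = \<phi> y \<Longrightarrow> x = y \<or> x \<in> R \<and> y \<in> R"
  shows "rooted_td k en' (\<phi> ` V) (g ` E) (\<phi> ` R)"
  using assms
proof (induction rule: rooted_td.induct)
  case (bag R E)
  then show ?case
    using card_image_le[of R \<phi>] by (intro rooted_td.bag) auto
next
  case (join V1 E1 R V2 E2)
  have "\<phi> ` V1 \<inter> \<phi> ` V2 = \<phi> ` R"
  proof
    show "\<phi> ` V1 \<inter> \<phi> ` V2 \<subseteq> \<phi> ` R"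
    proof
      fix z assume "z \<in> \<phi> ` V1 \<inter> \<phi> ` V2"
      then obtain x y where "x \<in> V1" "y \<in> V2" "z = \<phi> x" "\<phi> x = \<phi> y" by blast
      then show "z \<in> \<phi> ` R" using join.prems(2)[of x y] join.hyps(3) by blast
    qed
  qed (use join.hyps(3) in blast)
  moreover have "rooted_td k en' (\<phi> ` V1) (g ` E1) (\<phi> ` R)"
    "rooted_td k en' (\<phi> ` V2) (g ` E2) (\<phi> ` R)"
    using join.prems by (intro join.IH; blast)+
  ultimately show ?case unfolding image_Un by (intro rooted_td.join)
next
  case (reroot V E R R' E')
  have col: "x = y \<or> x \<in> R' \<and> y \<in> R'" if "x \<in> V \<union> R'" "y \<in> V \<union> R'" "\<phi> x = \<phi> y" for x y
    using reroot.prems(2) that by blast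
  \<comment> \<open>Distinct vertices of \<open>V\<close> that are identified lie in
    \<open>R' \<inter> V\<close>, hence in \<open>R\<close>: the hypothesis passes from the new root
    to the old one.\<close>
  have "rooted_td k en' (\<phi> ` V) (g ` E) (\<phi> ` R)"
    using reroot.prems(1) col reroot.hyps(4) by (intro reroot.IH) blast+
  moreover have "\<phi> ` R' \<inter> \<phi> ` V \<subseteq> \<phi> ` R"
  proof
    fix z assume "z \<in> \<phi> ` R' \<inter> \<phi> ` V"
    then obtain x y where "x \<in> R'" "y \<in> V" "z = \<phi> y" "\<phi> x = \<phi> y" by auto
    then show "z \<in> \<phi> ` R" using col[of x y] reroot.hyps(4) by blast
  qed
  moreover have "card (\<phi> ` R') \<le> k" "finite (\<phi> ` R')"
    using reroot.hyps(2,3) card_image_le[of R' \<phi>] by auto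
  moreover have "\<forall>e \<in> g ` E'. en' e \<subseteq> \<phi> ` R'"
    using reroot.prems(1) reroot.hyps(5) by blast
  ultimately show ?case unfolding image_Un by (intro rooted_td.reroot)
qed


section \<open>Walks and trees\<close>

lemma walk_Cons:
  "walk G (u # v # vs) (e # es) \<longleftrightarrow>
     u \<in> verts G \<and> e \<in> edges G \<and> ends G e = {u, v} \<and> walk G (v # vs) es"
  unfolding walk_def by (auto simp: nth_Cons' less_Suc_eq_0_disj)

lemma walk_single: "walk G [v] es \<longleftrightarrow> v \<in> verts G \<and> es = []"
  by (auto simp: walk_def)

lemma walk_append:
  assumes "walk G vs es" "walk G ws fs" "e \<in> edges G" "ends G e = {last vs, hd ws}"
  shows "walk G (vs @ ws) (es @ e # fs)"
  using assms(1,4)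
proof (induction es arbitrary: vs)
  case Nil
  then obtain v where "vs = [v]" by (auto simp: walk_def length_Suc_conv)
  moreover obtain w ws' where "ws = w # ws'" using assms(2) by (cases ws) (auto simp: walk_def)
  ultimately show ?case using Nil assms by (auto simp: walk_Cons walk_single)
next
  case (Cons d es)
  then obtain u v vs' where "vs = u # v # vs'" by (auto simp: walk_def length_Suc_conv)
  then show ?case using Cons.IH[of "v # vs'"] Cons.prems by (auto simp: walk_Cons)
qed

lemma walk_rev:
  assumes "walk G vs es"
  shows "walk G (rev vs) (rev es)"
  using assms
proof (induction es arbitrary: vs)
  case Nil
  then show ?case by (auto simp: walk_def length_Suc_conv)
next
  case (Cons d es)
  then obtain u v vs' where vs: "vs = u # v # vs'" by (auto simp: walk_def length_Suc_conv)
  then have "walk G (v # vs') es" "walk G [u] []"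
    using Cons.prems by (auto simp: walk_Cons walk_single)
  then have "walk G (rev (v # vs')) (rev es)" "walk G [u] []"
    using Cons.IH by blast+
  from walk_append[OF this, of d] show ?case using vs Cons.prems by (auto simp: walk_Cons)
qed

lemma walk_length: "walk G vs es \<Longrightarrow> length vs = Suc (length es)"
  by (simp add: walk_def)

lemma walk_take:
  assumes "walk G vs es" "n \<le> length es"
  shows "walk G (take (Suc n) vs) (take n es)"
  using assms set_take_subset[of "Suc n" vs] set_take_subset[of n es] unfolding walk_def by auto

definition adjacency :: "('v, 'e) ugraph \<Rightarrow> ('v \<times> 'v) set" where
  "adjacency G = {(u, v). \<exists>e \<in> edges G. ends G e = {u, v}}"

text \<open>Connectedness inside a set of nodes as a relation, which suits splitting a tree. The
  closure is reflexive on the whole type, also outside \<open>N\<close>; hence the separate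
  hypothesis \<open>u \<in> N\<close> when a path is extracted.\<close>

abbreviation reach :: "('v, 'e) ugraph \<Rightarrow> 'v set \<Rightarrow> ('v \<times> 'v) set" where
  "reach G N \<equiv> (adjacency G \<inter> N \<times> N)\<^sup>*"

lemma reach_path:
  assumes "(u, v) \<in> reach G N" "u \<in> N" "N \<subseteq> verts G"
  shows "\<exists>vs es. path G vs es \<and> hd vs = u \<and> last vs = v \<and> set vs \<subseteq> N"
  using assms(1)
proof (induction rule: rtrancl_induct)
  case base
  have "path G [u] []" using assms by (auto simp: path_def walk_single)
  then show ?case using assms(2) by fastforce
next
  case (step v w)
  then obtain vs es where p: "path G vs es" "hd vs = u" "last vs = v" "set vs \<subseteq> N" by blast
  obtain e where e: "e \<in> edges G" "ends G e = {v, w}" "w \<in> N"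
    using step(2) by (auto simp: adjacency_def)
  have ne: "vs \<noteq> []" using p(1) by (auto simp: path_def walk_def)
  show ?case
  proof (cases "w \<in> set vs")
    case True
    then obtain as bs where vs: "vs = as @ w # bs" by (auto dest: split_list)
    \<comment> \<open>On return to a visited vertex the path is cut at that occurrence instead of
      being extended. A vertex list is one longer than its edge list, hence
      \<open>Suc\<close>.\<close>
    let ?vs = "take (Suc (length as)) vs" and ?es = "take (length as) es"
    have "length as \<le> length es" using p(1) vs by (auto simp: path_def dest: walk_length)
    then have "path G ?vs ?es"
      using p(1) walk_take[of G vs es "length as"] unfolding path_def by simp
    moreover have "hd ?vs = u" "last ?vs = w" using p(2) vs by (auto simp: hd_append)
    moreover have "set ?vs \<subseteq> N" using p(4) vs by auto
    ultimately show ?thesis by blast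
  next
    case False
    have "walk G (vs @ [w]) (es @ [e])"
      using walk_append[of G vs es "[w]" "[]" e] p e assms(3) by (auto simp: path_def walk_single)
    then have "path G (vs @ [w]) (es @ [e])" using p False by (auto simp: path_def)
    then show ?thesis using p e ne by (intro exI[of _ "vs @ [w]"] exI[of _ "es @ [e]"]) auto
  qed
qed

lemma walk_reach:
  assumes "walk G vs es"
  shows "(hd vs, last vs) \<in> reach G (verts G)"
  using assms
proof (induction es arbitrary: vs)
  case Nil
  then show ?case by (auto simp: walk_def length_Suc_conv)
next
  case (Cons d es)
  then obtain u v vs' where vs: "vs = u # v # vs'" by (auto simp: walk_def length_Suc_conv)
  then have "(u, v) \<in> adjacency G \<inter> verts G \<times> verts G" "(v, last vs) \<in> reach G (verts G)"
    using Cons.prems Cons.IH[of "v # vs'"] hd_in_set[of "v # vs'"]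
    by (auto simp: walk_Cons adjacency_def walk_def[of G "v # vs'"])
  then have "(u, last vs) \<in> reach G (verts G)" by (rule converse_rtrancl_into_rtrancl)
  then show ?case using vs by simp
qed

section \<open>Attaching a leaf to a tree\<close>

lemma tree_single: "tree \<lparr>verts = {v}, edges = {}, ends = en\<rparr>"
proof -
  let ?Y = "\<lparr>verts = {v}, edges = {}, ends = en\<rparr>"
  have "path ?Y [v] []" by (simp add: path_def walk_single)
  then have "connected_graph ?Y" by (fastforce simp: connected_graph_def)
  then show ?thesis by (auto simp: tree_def wf_ugraph_def cycle_def walk_def)
qed

definition attach_leaf :: "('v, 'e) ugraph \<Rightarrow> 'v \<Rightarrow> 'v \<Rightarrow> 'e \<Rightarrow> ('v, 'e) ugraph" where
  "attach_leaf Y i j m =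
     \<lparr>verts = insert j (verts Y), edges = insert m (edges Y), ends = (ends Y)(m := {i, j})\<rparr>"

context
  fixes Y :: "('v, 'e) ugraph" and i j :: 'v and m :: 'e
  assumes wf: "wf_ugraph Y" and i: "i \<in> verts Y" and j: "j \<notin> verts Y" and m: "m \<notin> edges Y"
begin

lemma walk_attach_leaf:
  assumes "walk Y vs es"
  shows "walk (attach_leaf Y i j m) vs es"
proof -
  have "es ! n \<noteq> m" if "n < length es" for n
    using assms m nth_mem[OF that] by (auto simp: walk_def)
  then show ?thesis using assms by (auto simp: walk_def attach_leaf_def)
qed

text \<open>By well-formedness the ends of the old edges lie in \<open>verts Y\<close>, which misses
  the fresh \<open>j\<close>.\<close>

lemma leaf_edge:
  assumes "e \<in> edges (attach_leaf Y i j m)" "j \<in> ends (attach_leaf Y i j m) e"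
  shows "e = m"
  using assms wf j by (auto simp: attach_leaf_def wf_ugraph_def split: if_splits)

lemma walk_avoiding_leaf:
  assumes w: "walk (attach_leaf Y i j m) vs es" and nj: "j \<notin> set vs"
  shows "walk Y vs es"
proof -
  have "es ! n \<noteq> m" if "n < length es" for n
  proof
    assume "es ! n = m"
    then have "j \<in> {vs ! n, vs ! Suc n}"
      using w that by (auto simp: walk_def attach_leaf_def doubleton_eq_iff)
    then show False using w nj that nth_mem[of n vs] nth_mem[of "Suc n" vs]
      by (auto simp: walk_def)
  qed
  then have "m \<notin> set es" by (auto simp: in_set_conv_nth)
  moreover have "ends Y (es ! n) = ends (attach_leaf Y i j m) (es ! n)" if "n < length es" for n
    using that \<open>m \<notin> set es\<close> nth_mem[OF that] by (auto simp: attach_leaf_def)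
  ultimately show ?thesis
    using w nj unfolding walk_def by (auto simp: attach_leaf_def)
qed

lemma walk_edges_at_leaf:
  assumes w: "walk (attach_leaf Y i j m) vs es"
  shows "n < length es \<Longrightarrow> vs ! n = j \<Longrightarrow> es ! n = m \<and> vs ! Suc n = i"
    and "n < length es \<Longrightarrow> vs ! Suc n = j \<Longrightarrow> es ! n = m \<and> vs ! n = i"
proof -
  have e: "ends (attach_leaf Y i j m) (es ! n) = {vs ! n, vs ! Suc n}"
    "es ! n \<in> edges (attach_leaf Y i j m)" if "n < length es"
    using w that by (auto simp: walk_def)
  have *: "es ! n = m \<and> {vs ! n, vs ! Suc n} = {i, j}"
    if "n < length es" "j \<in> {vs ! n, vs ! Suc n}"
  proof -
    have "es ! n = m" using e that leaf_edge by metis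
    then show ?thesis using e(1) that by (auto simp: attach_leaf_def)
  qed
  have "i \<noteq> j" using i j by blast
  then show "n < length es \<Longrightarrow> vs ! n = j \<Longrightarrow> es ! n = m \<and> vs ! Suc n = i"
    "n < length es \<Longrightarrow> vs ! Suc n = j \<Longrightarrow> es ! n = m \<and> vs ! n = i"
    using * by (auto simp: doubleton_eq_iff)
qed

text \<open>An inner occurrence of \<open>j\<close> would have \<open>i\<close> both before and
  after it, against distinctness.\<close>

lemma path_leaf_end:
  assumes p: "path (attach_leaf Y i j m) vs es" and "j \<in> set vs"
  shows "hd vs = j \<or> last vs = j"
proof (rule ccontr)
  assume nj: "\<not> ?thesis"
  have w: "walk (attach_leaf Y i j m) vs es" and d: "distinct vs"
    and l: "length vs = Suc (length es)" using p by (auto simp: path_def walk_def)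
  obtain n where n: "n < length vs" "vs ! n = j" using assms(2) by (auto simp: in_set_conv_nth)
  have "vs \<noteq> []" using l by auto
  then have "n \<noteq> 0" "n \<noteq> length es"
    using nj n l by (auto simp: hd_conv_nth last_conv_nth intro: gr0I)
  then obtain n' where n': "n = Suc n'" "n < length es" using n l by (cases n) auto
  have "vs ! n' = i" "vs ! Suc n = i"
    using walk_edges_at_leaf(2)[OF w, of n'] walk_edges_at_leaf(1)[OF w, of n] n n' by auto
  then show False using d n' l nth_eq_iff_index_eq[OF d, of n' "Suc n"] by auto
qed

text \<open>Passing through \<open>j\<close> uses \<open>m\<close> on the way in and on the way out,
  against the distinctness of the edges. If \<open>j\<close> is the base point, \<open>m\<close> is
  both the first and the last edge, so it is the only one and \<open>i = j\<close>.\<close>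

lemma cycle_avoids_leaf:
  assumes c: "cycle (attach_leaf Y i j m) vs es"
  shows "j \<notin> set vs"
proof
  assume "j \<in> set vs"
  have w: "walk (attach_leaf Y i j m) vs es" and d: "distinct es"
    and l: "length vs = Suc (length es)" and e: "es \<noteq> []" and h: "hd vs = last vs"
    using c by (auto simp: cycle_def walk_def)
  obtain n where n: "n < length vs" "vs ! n = j" using \<open>j \<in> set vs\<close> by (auto simp: in_set_conv_nth)
  have vn: "vs \<noteq> []" using l by auto
  have h': "vs ! 0 = vs ! length es" using h vn l by (simp add: hd_conv_nth last_conv_nth)
  show False
  proof (cases "n = 0 \<or> n = length es")
    case True
    then have "vs ! 0 = j" "vs ! Suc (length es - 1) = j" using h' n e by auto
    then have "es ! 0 = m" "es ! (length es - 1) = m" "vs ! Suc 0 = i"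
      using walk_edges_at_leaf(1)[OF w, of 0] walk_edges_at_leaf(2)[OF w, of "length es - 1"] e
      by auto
    then have "length es = 1" using d e nth_eq_iff_index_eq[OF d, of 0 "length es - 1"]
      by (cases es) auto
    then have "vs ! 0 = i" using \<open>vs ! Suc 0 = i\<close> h' by auto
    then show False using \<open>vs ! 0 = j\<close> i j by auto
  next
    case False
    then obtain n' where n': "n = Suc n'" "n < length es" using n l by (cases n) auto
    then have "es ! n' = m" "es ! n = m"
      using walk_edges_at_leaf(2)[OF w, of n'] walk_edges_at_leaf(1)[OF w, of n] n by auto
    then show False using nth_eq_iff_index_eq[OF d, of n' n] n' by auto
  qed
qed

lemma tree_attach_leaf:
  assumes "tree Y"
  shows "tree (attach_leaf Y i j m)"
proof -
  let ?Y = "attach_leaf Y i j m"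
  have "wf_ugraph ?Y"
    using wf i by (auto simp: wf_ugraph_def attach_leaf_def card_insert_if)
  moreover have "connected_graph ?Y"
    unfolding connected_graph_def
  proof (intro conjI ballI)
    show "verts ?Y \<noteq> {}" by (simp add: attach_leaf_def)
    have to_j: "\<exists>vs es. path ?Y vs es \<and> hd vs = u \<and> last vs = j" if u: "u \<in> verts ?Y" for u
    proof (cases "u = j")
      case True
      then show ?thesis
        using u by (intro exI[of _ "[j]"] exI[of _ "[]"]) (auto simp: path_def walk_single)
    next
      case False
      then have "u \<in> verts Y" using u by (simp add: attach_leaf_def)
      then obtain vs es where p: "path Y vs es" "hd vs = u" "last vs = i"
        using assms i unfolding tree_def connected_graph_def by blast
      then have "walk ?Y vs es" "vs \<noteq> []" "j \<notin> set vs"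
        using walk_attach_leaf j by (auto simp: path_def) (auto simp: walk_def)
      moreover have "walk ?Y [j] []" by (simp add: walk_single attach_leaf_def)
      ultimately have "path ?Y (vs @ [j]) (es @ [m])"
        using walk_append[of ?Y vs es "[j]" "[]" m] p
        by (auto simp: path_def attach_leaf_def)
      then show ?thesis
        using p \<open>vs \<noteq> []\<close> by (intro exI[of _ "vs @ [j]"] exI[of _ "es @ [m]"]) auto
    qed
    fix u v assume uv: "u \<in> verts ?Y" "v \<in> verts ?Y"
    show "\<exists>vs es. path ?Y vs es \<and> hd vs = u \<and> last vs = v"
    proof (cases "u = j \<or> v = j")
      case True
      then show ?thesis
      proof
        assume "u = j"
        obtain vs es where "path ?Y vs es" "hd vs = v" "last vs = j" using to_j uv by blast
        then have "path ?Y (rev vs) (rev es)" "hd (rev vs) = u" "last (rev vs) = v"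
          using walk_rev \<open>u = j\<close> by (auto simp: path_def hd_rev last_rev)
        then show ?thesis by blast
      qed (use to_j uv in blast)
    next
      case False
      then have "u \<in> verts Y" "v \<in> verts Y" using uv by (auto simp: attach_leaf_def)
      then show ?thesis
        using assms walk_attach_leaf unfolding tree_def connected_graph_def path_def by blast
    qed
  qed
  moreover have "\<not> cycle ?Y vs es" for vs es
    using cycle_avoids_leaf[of vs es] walk_avoiding_leaf[of vs es] assms
    unfolding tree_def cycle_def by blast
  ultimately show ?thesis by (simp add: tree_def)
qed

text \<open>A path of positive length into \<open>j\<close> comes through \<open>i\<close>. A vertex
  shared by \<open>R\<close> and the bag at the other end lies in \<open>V \<inter> R\<close>, hence
  in \<open>t i\<close>, and the condition on the path without \<open>j\<close> takes over. Paths
  starting at \<open>j\<close> are reversed.\<close>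

lemma tree_decomposition_attach_leaf:
  assumes td: "tree_decomposition \<lparr>verts = V, edges = E, ends = en\<rparr> Y t" and R: "V \<inter> R \<subseteq> t i"
  shows "tree_decomposition \<lparr>verts = V \<union> R, edges = E, ends = en\<rparr> (attach_leaf Y i j m) (t(j := R))"
proof -
  let ?Y = "attach_leaf Y i j m" and ?t = "t(j := R)"
  have t: "tree Y" "(\<Union>i \<in> verts Y. t i) = V" "\<And>e. e \<in> E \<Longrightarrow> \<exists>i \<in> verts Y. en e \<subseteq> t i"
    and p: "\<And>vs es l. path Y vs es \<Longrightarrow> l \<in> set vs \<Longrightarrow> t (hd vs) \<inter> t (last vs) \<subseteq> t l"
    using td unfolding tree_decomposition_def by auto blast
  have tt: "?t l = t l" if "l \<in> verts Y" for l using that j by auto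
  have last: "?t (hd vs) \<inter> ?t (last vs) \<subseteq> ?t l"
    if pa: "path ?Y vs es" and l: "l \<in> set vs" and lj: "last vs = j" for vs es l
  \<comment> \<open>The one-vertex path at \<open>j\<close> does not visit \<open>i\<close> and is
    treated apart.\<close>
  proof (cases "length vs = 1")
    case True
    then obtain v where "vs = [v]" by (auto simp: length_Suc_conv)
    then show ?thesis using l by auto
  next
    case False
    have w: "walk ?Y vs es" and d: "distinct vs" and len: "length vs = Suc (length es)"
      using pa by (auto simp: path_def walk_def)
    define n where "n = length es - 1"
    have es: "length es = Suc n" using False len by (auto simp: n_def)
    have vn: "vs \<noteq> []" using len by auto
    have vsn: "vs ! Suc n = j" using lj vn len es by (simp add: last_conv_nth)
    have vi: "vs ! n = i" using walk_edges_at_leaf(2)[OF w, of n] vsn es by auto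
    let ?ws = "take (Suc n) vs"
    have vs: "vs = ?ws @ [j]"
      using len es vsn take_Suc_conv_app_nth[of "Suc n" vs] by auto
    then have "j \<notin> set ?ws" using d by (metis distinct_append disjoint_insert(1) list.set(2))
    moreover have "walk ?Y ?ws (take n es)" using walk_take[OF w, of n] es by auto
    ultimately have "path Y ?ws (take n es)" using walk_avoiding_leaf d by (auto simp: path_def)
    moreover have "last ?ws = i" using vi len es by (simp add: take_Suc_conv_app_nth)
    moreover have "hd ?ws = hd vs" using vn by simp
    ultimately have q: "t (hd vs) \<inter> t i \<subseteq> t l" if "l \<in> set ?ws" for l using p that by metis
    have ws: "set ?ws \<subseteq> verts Y"
      using \<open>path Y ?ws (take n es)\<close> by (auto simp: path_def walk_def)
    have "hd vs \<in> verts Y" using ws \<open>hd ?ws = hd vs\<close> vn by (metis hd_in_set subsetD take_eq_Nil nat.distinct(1))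
    then have "?t (hd vs) \<inter> R \<subseteq> t (hd vs) \<inter> t i"
      using tt t(2) R by auto
    moreover have "l = j \<or> l \<in> set ?ws" using l vs by (metis Un_iff empty_iff insert_iff list.set set_append)
    moreover have "?t l = t l" if "l \<in> set ?ws" using that ws tt by blast
    ultimately show ?thesis using q[of l] lj by (metis fun_upd_same inf_le2 order_trans)
  qed
  have "?t (hd vs) \<inter> ?t (last vs) \<subseteq> ?t l" if pa: "path ?Y vs es" and l: "l \<in> set vs" for vs es l
  proof (cases "j \<in> set vs")
    case True
    from path_leaf_end[OF pa True] show ?thesis
    proof
      assume "hd vs = j"
      moreover have "path ?Y (rev vs) (rev es)" using pa walk_rev by (auto simp: path_def)
      ultimately show ?thesis using last[of "rev vs" "rev es" l] l by (auto simp: hd_rev last_rev)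
    qed (use last pa l in blast)
  next
    case False
    then have "path Y vs es" using pa walk_avoiding_leaf by (auto simp: path_def)
    moreover have "vs \<noteq> []" using l by auto
    ultimately show ?thesis using p[of vs es l] l False hd_in_set[of vs] last_in_set[of vs]
      by (auto split: if_splits)
  qed
  moreover have "(\<Union>l \<in> verts ?Y. ?t l) = V \<union> R"
    unfolding attach_leaf_def using t(2) tt by (simp del: fun_upd_apply) (simp add: Un_commute)
  moreover have "\<exists>l \<in> verts ?Y. en e \<subseteq> ?t l" if "e \<in> E" for e
    using t(3)[OF that] tt by (fastforce simp: attach_leaf_def)
  ultimately show ?thesis
    using tree_attach_leaf[OF t(1)] by (simp add: tree_decomposition_def)
qed

end

section \<open>Realising rooted decompositions by trees\<close>

lemma tree_decomposition_add_edges: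
  assumes "tree_decomposition \<lparr>verts = V, edges = E, ends = en\<rparr> Y t"
    and "\<And>e. e \<in> F \<Longrightarrow> en e \<subseteq> t i" "i \<in> verts Y"
  shows "tree_decomposition \<lparr>verts = V, edges = E \<union> F, ends = en\<rparr> Y t"
proof -
  have "\<forall>e \<in> F. \<exists>i \<in> verts Y. en e \<subseteq> t i" using assms(2,3) by blast
  then show ?thesis using assms(1) by (simp add: tree_decomposition_def ball_Un)
qed

text \<open>Grafting onto an arbitrary given decomposition makes attaching leaves the only operation needed
  on trees.\<close>

lemma rooted_td_extend:
  fixes Y :: "(nat, nat) ugraph"
  assumes "rooted_td k en V E R"
    and "tree_decomposition \<lparr>verts = V', edges = E', ends = en\<rparr> Y t"
    and "\<forall>l \<in> verts Y. card (t l) \<le> k" and "i \<in> verts Y" "R \<subseteq> t i" "V' \<inter> V \<subseteq> R"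
  shows "\<exists>(Y' :: (nat, nat) ugraph) t'.
    tree_decomposition \<lparr>verts = V' \<union> V, edges = E' \<union> E, ends = en\<rparr> Y' t' \<and>
    (\<forall>l \<in> verts Y'. card (t' l) \<le> k) \<and>
    verts Y \<subseteq> verts Y' \<and> (\<forall>l \<in> verts Y. t' l = t l)"
  using assms
proof (induction arbitrary: V' E' Y t i rule: rooted_td.induct)
  case (bag R E)
  have "R \<subseteq> V'" using bag.prems by (auto simp: tree_decomposition_def)
  then have "tree_decomposition \<lparr>verts = V' \<union> R, edges = E' \<union> E, ends = en\<rparr> Y t"
    using tree_decomposition_add_edges[OF bag.prems(1) _ bag.prems(3), of E] bag
    by (force simp: Un_absorb2)
  then show ?case using bag.prems by blast
next
  case (join V1 E1 R V2 E2)
  have "V' \<inter> V1 \<subseteq> R" using join.prems(5) by blast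
  then obtain Y' :: "(nat, nat) ugraph" and t' where
    1: "tree_decomposition \<lparr>verts = V' \<union> V1, edges = E' \<union> E1, ends = en\<rparr> Y' t'"
    "\<forall>l \<in> verts Y'. card (t' l) \<le> k" "verts Y \<subseteq> verts Y'" "\<forall>l \<in> verts Y. t' l = t l"
    using join.IH(1)[OF join.prems(1-4)] by blast
  \<comment> \<open>Both halves are grafted at the same node \<open>i\<close>; for this the claim
    records that old nodes and their bags survive.\<close>
  have "i \<in> verts Y'" "R \<subseteq> t' i" "(V' \<union> V1) \<inter> V2 \<subseteq> R"
    using 1(3,4) join.prems join.hyps(3) by auto
  from join.IH(2)[OF 1(1,2) this] 1(3,4) show ?case by (fastforce simp: Un_assoc)
next
  case (reroot V E R R' F)
  have wf: "wf_ugraph Y" using reroot.prems(1) by (simp add: tree_decomposition_def tree_def)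
  obtain j where j: "j \<notin> verts Y" using wf by (metis ex_new_if_finite infinite_UNIV_nat wf_ugraph_def)
  obtain m where m: "m \<notin> edges Y" using wf by (metis ex_new_if_finite infinite_UNIV_nat wf_ugraph_def)
  have R: "finite R" "card R \<le> k" "R \<subseteq> V" using rooted_td_root[OF reroot.hyps(1)] .
  \<comment> \<open>\<open>R'\<close> is already contained in \<open>t i\<close>, so the new leaf
    carries the old root \<open>R\<close>: the tree grows downwards from the root, whereas
    \<open>rooted_td\<close> builds upwards.\<close>
  let ?Y = "attach_leaf Y i j m" and ?t = "t(j := R)"
  have RV: "R' \<subseteq> V'" using reroot.prems by (auto simp: tree_decomposition_def)
  have "V' \<inter> R \<subseteq> t i" using reroot.prems(4,5) R(3) by blast
  then have td: "tree_decomposition \<lparr>verts = V' \<union> R, edges = E', ends = en\<rparr> ?Y ?t"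
    using tree_decomposition_attach_leaf[OF wf reroot.prems(3) j m reroot.prems(1)] by blast
  have iY: "i \<in> verts ?Y" "R' \<subseteq> ?t i"
    using reroot.prems(3,4) j by (auto simp: attach_leaf_def)
  have td: "tree_decomposition \<lparr>verts = V' \<union> R, edges = E' \<union> F, ends = en\<rparr> ?Y ?t"
    using reroot.hyps(5) iY by (intro tree_decomposition_add_edges[OF td, of _ i]) blast+
  have "\<forall>l \<in> verts ?Y. card (?t l) \<le> k" using reroot.prems(2) R(2) by (auto simp: attach_leaf_def)
  moreover have "j \<in> verts ?Y" "R \<subseteq> ?t j" by (auto simp: attach_leaf_def)
  moreover have "(V' \<union> R) \<inter> V \<subseteq> R" using reroot.prems(5) reroot.hyps(4) by blast
  ultimately obtain Y' :: "(nat, nat) ugraph" and t' where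
    2: "tree_decomposition \<lparr>verts = (V' \<union> R) \<union> V, edges = (E' \<union> F) \<union> E, ends = en\<rparr> Y' t'"
    "\<forall>l \<in> verts Y'. card (t' l) \<le> k" "verts ?Y \<subseteq> verts Y'" "\<forall>l \<in> verts ?Y. t' l = ?t l"
    using reroot.IH[OF td] by blast
  have "(V' \<union> R) \<union> V = V' \<union> (V \<union> R')" "(E' \<union> F) \<union> E = E' \<union> (E \<union> F)"
    using R(3) RV by blast+
  moreover have "verts Y \<subseteq> verts Y'" "\<forall>l \<in> verts Y. t' l = t l"
    using 2(3,4) j by (auto simp: attach_leaf_def)
  ultimately show ?case using 2(1,2) by metis
qed

lemma tw_le:
  assumes td: "tree_decomposition G (Y :: (nat, nat) ugraph) t"
    and k: "\<forall>l \<in> verts Y. card (t l) \<le> k"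
  shows "tw G \<le> k"
proof -
  have "finite (verts Y)" "verts Y \<noteq> {}"
    using td by (auto simp: tree_decomposition_def tree_def wf_ugraph_def connected_graph_def)
  then have "td_width Y t \<le> k" using k by (simp add: td_width_def)
  moreover have "tw G \<le> td_width Y t" unfolding tw_def using td by (intro Least_le) blast
  ultimately show ?thesis by simp
qed

lemma tree_decomposition_single:
  assumes "\<And>e. e \<in> edges G \<Longrightarrow> ends G e \<subseteq> verts G"
  shows "tree_decomposition G \<lparr>verts = {v}, edges = {}, ends = en\<rparr> (\<lambda>_. verts G)"
  using assms tree_single[of v en] by (auto simp: tree_decomposition_def)

lemma rooted_td_tw_le:
  assumes "rooted_td k (ends G) (verts G) (edges G) R"
  shows "tw G \<le> k"
proof -
  let ?Y = "\<lparr>verts = {0}, edges = {}, ends = \<lambda>_. {}\<rparr> :: (nat, nat) ugraph"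
  have R: "finite R" "card R \<le> k" "R \<subseteq> verts G" using rooted_td_root[OF assms] .
  \<comment> \<open>The initial tree is a single node with bag \<open>R\<close> that covers no edges
    yet; everything else is grafted onto it.\<close>
  have "tree_decomposition \<lparr>verts = R, edges = {}, ends = ends G\<rparr> ?Y (\<lambda>_. R)"
    using tree_decomposition_single[of "\<lparr>verts = R, edges = {}, ends = ends G\<rparr>"] by simp
  from rooted_td_extend[OF assms this, of 0] R obtain Y' :: "(nat, nat) ugraph" and t' where
    "tree_decomposition \<lparr>verts = verts G, edges = edges G, ends = ends G\<rparr> Y' t'"
    "\<forall>l \<in> verts Y'. card (t' l) \<le> k"
    by (auto simp: Un_absorb1)
  moreover from this(1) have "tree_decomposition G Y' t'" by (simp add: tree_decomposition_def)
  ultimately show ?thesis by (intro tw_le)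
qed


section \<open>From monoidal decompositions to tree decompositions\<close>

definition cospan_td :: "nat \<Rightarrow> ('v, 'e) cospan \<Rightarrow> bool" where
  "cospan_td k f \<longleftrightarrow>
     rooted_td k (ends (apex f)) (verts (apex f)) (edges (apex f)) (legl f ` src f)"

lemma cospan_td_mono: "cospan_td k f \<Longrightarrow> k \<le> k' \<Longrightarrow> cospan_td k' f"
  unfolding cospan_td_def by (rule rooted_td_mono)

lemma cospan_td_iso:
  assumes "cospan_iso f g" "cospan_td k f"
  shows "cospan_td k g"
proof -
  obtain a b where ab: "ugraph_iso a b (apex f) (apex g)"
    "\<forall>x \<in> src f. a (legl f x) = legl g x" and src: "src f = src g"
    using assms(1) by (auto simp: cospan_iso_def)
  have "rooted_td k (ends (apex g)) (a ` verts (apex f)) (b ` edges (apex f)) (a ` legl f ` src f)"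
    using ab(1) by (intro rooted_td_image[OF assms(2)[unfolded cospan_td_def]])
      (auto simp: ugraph_iso_def ugraph_hom_def bij_betw_def dest: inj_onD)
  moreover have "a ` legl f ` src f = legl g ` src g"
    using ab(2) src unfolding image_image by (intro image_cong) auto
  ultimately show ?thesis
    using ab(1) by (simp add: cospan_td_def ugraph_iso_def bij_betw_def)
qed

section \<open>Vertices identified by a pushout\<close>

text \<open>The closure in \<open>glue_rel\<close> is not analysed: a pair of maps that agree along
  the boundary is constant on classes. The test maps send the whole left side and the boundary image
  on the right to \<open>None\<close> and keep the remaining vertices apart.\<close>

lemma glue_Inr:
  assumes "glue f g (Inr v) = glue f g (Inr w)"
  shows "v = w \<or> v \<in> legl g ` tgt f \<and> w \<in> legl g ` tgt f"
proof -
  define q where "q v = (if v \<in> legl g ` tgt f then None else Some v)" for v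
  from glue_rel_respects[OF _ assms[unfolded glue_eq_iff], of "\<lambda>_. None" q] show ?thesis by (auto simp: q_def split: if_splits)
qed

lemma glue_Inl_Inr:
  assumes "glue f g (Inl v) = glue f g (Inr w)"
  shows "w \<in> legl g ` tgt f"
proof -
  define q where "q v = (if v \<in> legl g ` tgt f then None else Some v)" for v
  from glue_rel_respects[OF _ assms[unfolded glue_eq_iff], of "\<lambda>_. None" q] show ?thesis by (auto simp: q_def split: if_splits)
qed

text \<open>As the leg is injective, \<open>q\<close> can send each boundary vertex on the right to
  the left vertex it is glued to. Then \<open>case_sum Inl q\<close> is constant on classes and the
  identity on the left side.\<close>

lemma glue_Inl_inj:
  assumes "glue f g (Inl v) = glue f g (Inl w)" "inj_on (legl g) (tgt f)"
  shows "v = w"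
proof -
  define q where "q v = (if v \<in> legl g ` tgt f then Inl (legr f (the_inv_into (tgt f) (legl g) v))
    else Inr v)" for v
  have "case_sum Inl q (Inl v) = case_sum Inl q (Inl w)"
    by (rule glue_rel_respects[OF _ assms(1)[unfolded glue_eq_iff]])
      (use assms(2) in \<open>simp add: q_def the_inv_into_f_f\<close>)
  then show ?thesis by simp
qed

section \<open>Decompositions of composites and tensors\<close>

text \<open>The decomposition of \<open>f\<close> survives the gluing since only vertices of its
  root are identified. All of \<open>apex h\<close> becomes the next root bag, which meets the rest
  only in glued vertices, and the image of \<open>src h\<close> is put on top.\<close>

lemma cospan_td_seq:
  assumes h: "wf_cospan h" "card (verts (apex h)) \<le> k" and f: "cospan_td k f"
    and comp: "tgt h = src f"
  shows "cospan_td k (cospan_seq h f)"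
proof -
  let ?l = "\<lambda>v. glue h f (Inl v)" and ?r = "\<lambda>v. glue h f (Inr v)"
  let ?en = "ends (pushout_graph h f)" and ?V = "verts (apex h)"
  have fin: "finite ?V" and legs: "legl h ` src h \<subseteq> ?V" "legr h ` tgt h \<subseteq> ?V"
    and ends: "e \<in> edges (apex h) \<Longrightarrow> ends (apex h) e \<subseteq> ?V" for e
    using h by (auto simp: wf_cospan_def wf_ugraph_def)
  have "rooted_td k ?en (?r ` verts (apex f)) (Inr ` edges (apex f)) (?r ` legl f ` src f)"
    using comp by (intro rooted_td_image[OF f[unfolded cospan_td_def]])
      (auto simp: pushout_graph_def image_image dest: glue_Inr)
  then have "rooted_td k ?en (?r ` verts (apex f) \<union> ?l ` ?V)
      (Inr ` edges (apex f) \<union> Inl ` edges (apex h)) (?l ` ?V)"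
  proof (rule rooted_td.reroot)
    show "finite (?l ` ?V)" "card (?l ` ?V) \<le> k"
      using fin h(2) card_image_le[OF fin, of ?l] by auto
    show "?l ` ?V \<inter> ?r ` verts (apex f) \<subseteq> ?r ` legl f ` src f"
      using glue_Inl_Inr[of h f] comp by auto
    show "\<forall>e \<in> Inl ` edges (apex h). ?en e \<subseteq> ?l ` ?V"
      using ends by (auto simp: pushout_graph_def)
  qed
  then have "rooted_td k ?en (?r ` verts (apex f) \<union> ?l ` ?V)
      (Inr ` edges (apex f) \<union> Inl ` edges (apex h)) (?l ` legl h ` src h)"
    by (rule rooted_td_subset) (use legs in blast)
  moreover have "?r ` verts (apex f) \<union> ?l ` ?V = verts (pushout_graph h f)"
    by (auto simp: pushout_graph_def Plus_def image_Un image_image)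
  moreover have "Inr ` edges (apex f) \<union> Inl ` edges (apex h) = edges (pushout_graph h f)"
    by (auto simp: pushout_graph_def)
  ultimately show ?thesis
    by (simp add: cospan_td_def cospan_seq_def image_image comp_def)
qed

text \<open>\<open>join\<close> asks for one common root, so both sides are first rerooted at the
  same bag; in a disjoint sum they meet nowhere else.\<close>

lemma cospan_td_par:
  fixes f :: "('v, 'e) cospan" and g :: "('w, 'd) cospan"
  assumes "cospan_td k f" "cospan_td k g" "finite (src f)" "finite (src g)"
    and "card (src f) + card (src g) \<le> k"
  shows "cospan_td k (cospan_par f g)"
proof -
  let ?en = "ends (sum_graph (apex f) (apex g))"
  let ?R1 = "Inl ` legl f ` src f :: ('v + 'w) set"
  let ?R2 = "Inr ` legl g ` src g :: ('v + 'w) set"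
  let ?R = "?R1 \<union> ?R2" and ?V1 = "Inl ` verts (apex f)" and ?V2 = "Inr ` verts (apex g)"
  have R: "finite ?R" "card ?R \<le> k"
  proof -
    have "card ?R1 \<le> card (src f)" "card ?R2 \<le> card (src g)"
      unfolding image_image using assms(3,4) by (simp_all add: card_image_le)
    then show "card ?R \<le> k" using card_Un_le[of ?R1 ?R2] assms(5) by linarith
  qed (use assms(3,4) in simp)
  have sub: "?R1 \<subseteq> ?V1" "?R2 \<subseteq> ?V2"
    using assms(1,2) rooted_td_root(3) unfolding cospan_td_def by blast+
  have "rooted_td k ?en ?V1 (Inl ` edges (apex f)) ?R1"
    by (rule rooted_td_image[OF assms(1)[unfolded cospan_td_def]]) (auto simp: sum_graph_def)
  then have 1: "rooted_td k ?en (?V1 \<union> ?R) (Inl ` edges (apex f) \<union> {}) ?R"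
    using R by (rule rooted_td.reroot) auto
  have "rooted_td k ?en ?V2 (Inr ` edges (apex g)) ?R2"
    by (rule rooted_td_image[OF assms(2)[unfolded cospan_td_def]]) (auto simp: sum_graph_def)
  then have 2: "rooted_td k ?en (?V2 \<union> ?R) (Inr ` edges (apex g) \<union> {}) ?R"
    using R by (rule rooted_td.reroot) auto
  have "(?V1 \<union> ?R) \<inter> (?V2 \<union> ?R) = ?R" by auto
  note * = rooted_td.join[OF 1 2 this]
  have "rooted_td k ?en (?V1 \<union> ?V2) (Inl ` edges (apex f) \<union> Inr ` edges (apex g)) ?R"
  proof -
    have "(?V1 \<union> ?R) \<union> (?V2 \<union> ?R) = ?V1 \<union> ?V2" using sub by blast
    with *show ?thesis by (simp only: Un_empty_right)
  qed
  moreover have "legl (cospan_par f g) ` src (cospan_par f g) = ?R"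
    by (auto simp: cospan_par_def osum_def image_Un image_image)
  ultimately show ?thesis
    by (simp add: cospan_td_def cospan_par_def sum_graph_def Plus_def)
qed

text \<open>Associators and unitors contribute no vertices beyond the image of their left leg.\<close>

definition left_bijective :: "('v, 'e) cospan \<Rightarrow> bool" where
  "left_bijective f \<longleftrightarrow>
     edges (apex f) = {} \<and> bij_betw (legl f) (src f) (verts (apex f))"

lemma left_bijective_iso:
  assumes "cospan_iso f g" "left_bijective f"
  shows "left_bijective g"
proof -
  obtain a b where ab: "ugraph_iso a b (apex f) (apex g)"
    "\<And>x. x \<in> src f \<Longrightarrow> a (legl f x) = legl g x" and src: "src f = src g"
    using assms(1) by (auto simp: cospan_iso_def)
  have "bij_betw (a \<circ> legl f) (src f) (verts (apex g))"
    using assms(2) ab(1) by (auto simp: left_bijective_def ugraph_iso_def intro: bij_betw_trans)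
  then have "bij_betw (legl g) (src g) (verts (apex g))"
    using ab(2) src by (subst bij_betw_cong[of _ _ "a \<circ> legl f"]) auto
  then show ?thesis using ab(1) assms(2) by (auto simp: left_bijective_def ugraph_iso_def bij_betw_def)
qed

lemma left_bijective_seq:
  assumes "left_bijective f" "left_bijective g" "tgt f = src g" "wf_cospan f"
  shows "left_bijective (cospan_seq f g)"
proof -
  let ?l = "\<lambda>v. glue f g (Inl v)"
  have inj: "inj_on (legl g) (tgt f)" and g: "verts (apex g) = legl g ` tgt f"
    and f: "bij_betw (legl f) (src f) (verts (apex f))"
    using assms by (auto simp: left_bijective_def bij_betw_def)
  have "bij_betw ?l (verts (apex f)) (?l ` verts (apex f))"
    using glue_Inl_inj[OF _ inj] by (auto simp: bij_betw_def intro!: inj_onI)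
  from bij_betw_trans[OF f this]
  have "bij_betw (?l \<circ> legl f) (src f) (?l ` verts (apex f))" .
  moreover have "verts (pushout_graph f g) = ?l ` verts (apex f)"
  proof -
    have "glue f g (Inr w) \<in> ?l ` verts (apex f)" if w: "w \<in> verts (apex g)" for w
    proof -
      obtain c where "c \<in> tgt f" "w = legl g c" using w g by auto
      then show ?thesis using glue_legs[of c f g] assms(4)
        by (intro image_eqI[of _ _ "legr f c"]) (auto simp: wf_cospan_def)
    qed
    then show ?thesis by (auto simp: pushout_graph_def)
  qed
  ultimately show ?thesis
    using assms by (auto simp: left_bijective_def cospan_seq_def pushout_graph_def comp_def)
qed

lemma left_bijective_par:
  assumes "left_bijective f" "left_bijective g"
  shows "left_bijective (cospan_par f g)"
proof -
  have f: "inj_on (legl f) (src f)" "verts (apex f) = legl f ` src f"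
    and g: "inj_on (legl g) (src g)" "verts (apex g) = legl g ` src g"
    using assms by (auto simp: left_bijective_def bij_betw_def)
  have "inj_on (elem_case (Inl \<circ> legl f) (Inr \<circ> legl g)) (src f \<oplus>\<^sub>o src g)"
    using f(1) g(1) unfolding osum_def by (intro inj_onI) (auto dest: inj_onD)
  moreover have "elem_case (Inl \<circ> legl f) (Inr \<circ> legl g) ` (src f \<oplus>\<^sub>o src g) =
      verts (apex f) <+> verts (apex g)"
    unfolding f g osum_def Plus_def by (simp add: image_Un image_image)
  ultimately show ?thesis
    using assms by (simp add: left_bijective_def cospan_par_def sum_graph_def bij_betw_def)
qed

lemma left_bijective_mor_of_fun:
  assumes "bij_betw \<phi> A B" "f \<in> mor_of_fun A B \<phi>"
  shows "wf_cospan f \<and> src f = A \<and> tgt f = B \<and> left_bijective f"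
proof -
  let ?f = "\<lparr>src = A, tgt = B, apex = discrete B, legl = \<phi>, legr = id\<rparr>"
  have f: "wf_cospan f" "cospan_iso ?f f" using assms(2) by (auto simp: mor_of_fun_def cls_def)
  have "left_bijective ?f" using assms(1) by (simp add: left_bijective_def discrete_def)
  with f(2) have "left_bijective f" by (rule left_bijective_iso)
  then show ?thesis using f by (auto simp: cospan_iso_def)
qed

lemma in_seqE:
  assumes "c \<in> F ;; G"
  obtains f g where "f \<in> F" "g \<in> G" "wf_cospan c" "cospan_iso (cospan_seq f g) c"
    "src c = src f" "tgt c = tgt g"
proof -
  obtain f g where "f \<in> F" "g \<in> G" "wf_cospan c" "cospan_iso (cospan_seq f g) c"
    using assms by (auto simp: seq_def cls_def)
  moreover from this have "src c = src f" "tgt c = tgt g"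
    by (auto simp: cospan_iso_def cospan_seq_def)
  ultimately show thesis using that by blast
qed

lemma in_parE:
  assumes "c \<in> F \<otimes>\<^sub>m G"
  obtains f g where "f \<in> F" "g \<in> G" "wf_cospan c" "cospan_iso (cospan_par f g) c"
    "src c = src f \<oplus>\<^sub>o src g" "tgt c = tgt f \<oplus>\<^sub>o tgt g"
proof -
  obtain f g where "f \<in> F" "g \<in> G" "wf_cospan c" "cospan_iso (cospan_par f g) c"
    using assms by (auto simp: par_def cls_def)
  moreover from this have "src c = src f \<oplus>\<^sub>o src g" "tgt c = tgt f \<oplus>\<^sub>o tgt g"
    by (auto simp: cospan_iso_def cospan_par_def)
  ultimately show thesis using that by blast
qed

lemma finite_osum: "finite (A \<oplus>\<^sub>o B) \<longleftrightarrow> finite A \<and> finite B"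
  by (auto simp: osum_def finite_image_iff inj_on_def)

lemma card_osum: "finite A \<Longrightarrow> finite B \<Longrightarrow> card (A \<oplus>\<^sub>o B) = card A + card B"
  unfolding osum_def by (subst card_Un_disjoint) (auto simp: card_image inj_on_def)

lemma coherence_card: "coherence A B \<sigma> \<Longrightarrow> finite A \<and> finite B \<and> card A = card B"
  by (induction rule: coherence.induct) (simp_all add: card_osum finite_osum)

lemma coherence_left_bijective:
  assumes "coherence A B \<sigma>" "f \<in> \<sigma>"
  shows "wf_cospan f \<and> src f = A \<and> tgt f = B \<and> left_bijective f"
  using assms
proof (induction arbitrary: f rule: coherence.induct)
  case (comp A B \<sigma> C \<tau>)
  obtain s t where "s \<in> \<sigma>" "t \<in> \<tau>" "wf_cospan f" "cospan_iso (cospan_seq s t) f"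
    "src f = src s" "tgt f = tgt t" using comp.prems by (rule in_seqE)
  then show ?case using comp.IH left_bijective_seq[of s t] left_bijective_iso by metis
next
  case (tensor A B \<sigma> A' B' \<tau>)
  obtain s t where "s \<in> \<sigma>" "t \<in> \<tau>" "wf_cospan f" "cospan_iso (cospan_par s t) f"
    "src f = src s \<oplus>\<^sub>o src t" "tgt f = tgt s \<oplus>\<^sub>o tgt t" using tensor.prems by (rule in_parE)
  then show ?case using tensor.IH left_bijective_par[of s t] left_bijective_iso by metis
next
  case (ident A)
  then show ?case by (intro left_bijective_mor_of_fun) auto
next
  case (assoc A B C)
  have "bij_betw assoc_fun ((A \<oplus>\<^sub>o B) \<oplus>\<^sub>o C) (A \<oplus>\<^sub>o B \<oplus>\<^sub>o C)"
    by (rule bij_betw_byWitness[where f' = assoc_inv_fun]) (auto simp: osum_def)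
  then show ?case using assoc.prems by (rule left_bijective_mor_of_fun)
next
  case (assoc_inv A B C)
  have "bij_betw assoc_inv_fun (A \<oplus>\<^sub>o B \<oplus>\<^sub>o C) ((A \<oplus>\<^sub>o B) \<oplus>\<^sub>o C)"
    by (rule bij_betw_byWitness[where f' = assoc_fun]) (auto simp: osum_def)
  then show ?case using assoc_inv.prems by (rule left_bijective_mor_of_fun)
next
  case (unitl A)
  have "bij_betw (elem_case id id) ({} \<oplus>\<^sub>o A) A"
    by (rule bij_betw_byWitness[where f' = InR]) (auto simp: osum_def)
  then show ?case using unitl.prems by (rule left_bijective_mor_of_fun)
next
  case (unitl_inv A)
  have "bij_betw InR A ({} \<oplus>\<^sub>o A)"
    by (rule bij_betw_byWitness[where f' = "elem_case id id"]) (auto simp: osum_def)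
  then show ?case using unitl_inv.prems by (rule left_bijective_mor_of_fun)
next
  case (unitr A)
  have "bij_betw (elem_case id id) (A \<oplus>\<^sub>o {}) A"
    by (rule bij_betw_byWitness[where f' = InL]) (auto simp: osum_def)
  then show ?case using unitr.prems by (rule left_bijective_mor_of_fun)
next
  case (unitr_inv A)
  have "bij_betw InL A (A \<oplus>\<^sub>o {})"
    by (rule bij_betw_byWitness[where f' = "elem_case id id"]) (auto simp: osum_def)
  then show ?case using unitr_inv.prems by (rule left_bijective_mor_of_fun)
qed

text \<open>Injectivity of \<open>legl t\<close> keeps the left apex from collapsing and
  surjectivity leaves no vertex of \<open>t\<close> unglued, so the pushout is a copy of
  \<open>apex f\<close>. This serves for \<open>\<tau>\<close>, which stands to the right of a
  tensor, where \<open>cospan_td_seq\<close> would need a small left factor.\<close>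

lemma cospan_td_seq_left_bijective:
  assumes f: "cospan_td k f" and t: "left_bijective t" and comp: "tgt f = src t"
    and wf: "wf_cospan f"
  shows "cospan_td k (cospan_seq f t)"
proof -
  let ?l = "\<lambda>v. glue f t (Inl v)"
  have inj: "inj_on (legl t) (tgt f)" and tv: "verts (apex t) = legl t ` tgt f"
    using t comp by (auto simp: left_bijective_def bij_betw_def)
  have "rooted_td k (ends (pushout_graph f t)) (?l ` verts (apex f)) (Inl ` edges (apex f))
      (?l ` legl f ` src f)"
    by (rule rooted_td_image[OF f[unfolded cospan_td_def]])
      (auto simp: pushout_graph_def image_image dest: glue_Inl_inj[OF _ inj])
  moreover have "verts (pushout_graph f t) = ?l ` verts (apex f)"
  proof -
    have "glue f t (Inr w) \<in> ?l ` verts (apex f)" if w: "w \<in> verts (apex t)" for w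
    proof -
      obtain c where "c \<in> tgt f" "w = legl t c" using w tv by auto
      then show ?thesis using glue_legs[of c f t] wf
        by (intro image_eqI[of _ _ "legr f c"]) (auto simp: wf_cospan_def)
    qed
    then show ?thesis by (auto simp: pushout_graph_def)
  qed
  moreover have "edges (pushout_graph f t) = Inl ` edges (apex f)"
    using t by (auto simp: pushout_graph_def left_bijective_def)
  ultimately show ?thesis by (simp add: cospan_td_def cospan_seq_def image_image comp_def)
qed

section \<open>Induction over monoidal decompositions\<close>

lemma hom_memD:
  assumes "F \<in> hom A B" "f \<in> F"
  shows "wf_cospan f" "src f = A" "tgt f = B" "card (verts (apex f)) = weight F"
proof -
  obtain f0 :: "(nat, nat) cospan" where f0: "wf_cospan f0" "src f0 = A" "tgt f0 = B" "F = cls f0"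
    using assms(1) by (auto simp: hom_def)
  then have f: "wf_cospan f" "cospan_iso f0 f" using assms(2) by (auto simp: cls_def)
  then have "F = cls f" using f0 cls_eqI by metis
  then show "wf_cospan f" "src f = A" "tgt f = B" "card (verts (apex f)) = weight F"
    using f f0 weight_cls[of f] by (simp_all add: cospan_iso_def)
qed

lemma Drt_finite: "Drt A B F d \<Longrightarrow> finite A"
proof (induction rule: Drt.induct)
  case (leaf F A B)
  then show ?case by (auto simp: hom_def wf_cospan_def)
next
  case tensor
  then show ?case using coherence_card by blast
next
  case (comp H A C)
  then show ?case by (auto simp: hom_def wf_cospan_def)
qed

text \<open>\<open>seq\<close> and \<open>par\<close> take unions over representatives, so every
  member of \<open>F\<close> has to be covered; the clauses on \<open>src\<close> and
  \<open>tgt\<close> supply the matching of boundaries, which \<open>seq\<close> does not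
  demand.\<close>

lemma Drt_cospan_td:
  assumes "Drt A B F d" "f \<in> F"
  shows "wf_cospan f \<and> src f = A \<and> tgt f = B \<and> cospan_td (max (wd d) (card A)) f"
  using assms
proof (induction arbitrary: f rule: Drt.induct)
  case (leaf F A B)
  note f = hom_memD[OF leaf]
  then have "rooted_td (max (weight F) (card A)) (ends (apex f)) (verts (apex f)) (edges (apex f))
      (verts (apex f))"
    by (intro rooted_td.bag) (auto simp: wf_cospan_def wf_ugraph_def)
  moreover have "legl f ` src f \<subseteq> verts (apex f)" using f by (simp add: wf_cospan_def)
  ultimately show ?case using f rooted_td_subset by (auto simp: cospan_td_def)
next
  case (comp H A C B F1 d1)
  obtain h f1 where hf: "h \<in> H" "f1 \<in> F1" "wf_cospan f" "cospan_iso (cospan_seq h f1) f"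
    "src f = src h" "tgt f = tgt f1" using comp.prems by (rule in_seqE)
  note h = hom_memD[OF comp.hyps(1) hf(1)]
  have f1: "src f1 = C" "tgt f1 = B" "cospan_td (max (wd d1) (card C)) f1"
    using comp.IH[OF hf(2)] by auto
  \<comment> \<open>The width of a composition includes \<open>card C\<close>, which absorbs the
    boundary term of the induction hypothesis.\<close>
  have "cospan_td (max (wd (Comp H C d1)) (card A)) f1"
    using f1(3) by (rule cospan_td_mono) auto
  then have "cospan_td (max (wd (Comp H C d1)) (card A)) (cospan_seq h f1)"
    using h f1 by (intro cospan_td_seq) auto
  then show ?case using hf h f1 cospan_td_iso by auto
next
  case (tensor A1 B1 F1 d1 A2 B2 F2 d2 A \<sigma> B \<tau>)
  let ?k = "max (wd (Tensor d1 d2)) (card A)"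
  obtain x t where xt: "x \<in> \<sigma> ;; F1 \<otimes>\<^sub>m F2" "t \<in> \<tau>" "wf_cospan f" "cospan_iso (cospan_seq x t) f"
    "src f = src x" "tgt f = tgt t" using tensor.prems by (rule in_seqE)
  obtain s y where sy: "s \<in> \<sigma>" "y \<in> F1 \<otimes>\<^sub>m F2" "wf_cospan x" "cospan_iso (cospan_seq s y) x"
    "src x = src s" "tgt x = tgt y" using xt(1) by (rule in_seqE)
  obtain f1 f2 where f12: "f1 \<in> F1" "f2 \<in> F2" "wf_cospan y" "cospan_iso (cospan_par f1 f2) y"
    "src y = src f1 \<oplus>\<^sub>o src f2" "tgt y = tgt f1 \<oplus>\<^sub>o tgt f2" using sy(2) by (rule in_parE)
  have s: "wf_cospan s" "src s = A" "tgt s = A1 \<oplus>\<^sub>o A2" "left_bijective s"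
    using coherence_left_bijective[OF tensor.hyps(3) sy(1)] by auto
  have t: "wf_cospan t" "src t = B1 \<oplus>\<^sub>o B2" "tgt t = B" "left_bijective t"
    using coherence_left_bijective[OF tensor.hyps(4) xt(2)] by auto
  have fin: "finite A1" "finite A2" using tensor.hyps(1,2) Drt_finite by blast+
  have card: "card A = card A1 + card A2"
    using coherence_card[OF tensor.hyps(3)] card_osum fin by simp
  have f1: "src f1 = A1" "tgt f1 = B1" "cospan_td (max (wd d1) (card A1)) f1"
    using tensor.IH(1)[OF f12(1)] by auto
  have f2: "src f2 = A2" "tgt f2 = B2" "cospan_td (max (wd d2) (card A2)) f2"
    using tensor.IH(2)[OF f12(2)] by auto
  have "cospan_td ?k f1" using f1(3) by (rule cospan_td_mono) (use card in auto)
  moreover have "cospan_td ?k f2" using f2(3) by (rule cospan_td_mono) (use card in auto)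
  ultimately have "cospan_td ?k (cospan_par f1 f2)"
    using f1 f2 fin card by (intro cospan_td_par) auto
  then have "cospan_td ?k y" using f12(4) cospan_td_iso by blast
  \<comment> \<open>The isomorphism \<open>s\<close> is treated like an atomic first factor: its
    vertices are in bijection with \<open>A\<close>.\<close>
  moreover have "card (verts (apex s)) \<le> ?k"
    using s by (auto simp: left_bijective_def dest: bij_betw_same_card)
  ultimately have "cospan_td ?k (cospan_seq s y)"
    using s f12 f1 f2 by (intro cospan_td_seq) auto
  then have "cospan_td ?k x" using sy(4) cospan_td_iso by blast
  then have "cospan_td ?k (cospan_seq x t)"
    using t sy f12 f1 f2 by (intro cospan_td_seq_left_bijective) auto
  then have "cospan_td ?k f" using xt(4) cospan_td_iso by blast
  then show ?case using xt sy s t by simp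
qed

lemma tw_le_mtwd:
  assumes "wf_ugraph G"
  shows "tw G \<le> mtwd {} {} (closed_mor G)"
proof -
  let ?g = "\<lparr>src = {}, tgt = {}, apex = G, legl = (\<lambda>_. undefined), legr = (\<lambda>_. undefined)\<rparr>"
  let ?P = "\<lambda>w. \<exists>d. Drt {} {} (closed_mor G) d \<and> w = wd d"
  \<comment> \<open>Every morphism is atomic, so the minimum is taken over a nonempty set.\<close>
  have "?P (wd (Leaf (closed_mor G)))" using closed_mor_hom[OF assms] Drt.leaf by blast
  then have "?P (mtwd {} {} (closed_mor G))" unfolding mtwd_def by (rule LeastI)
  then obtain d where d: "Drt {} {} (closed_mor G) d" "mtwd {} {} (closed_mor G) = wd d" by blast
  have wf: "wf_cospan ?g" using assms by (simp add: wf_cospan_def)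
  then obtain c where c: "c \<in> cls ?g" using cls_nonempty by blast
  \<comment> \<open>The source is empty, so the term \<open>card A\<close> vanishes.\<close>
  then have "cospan_td (wd d) c" using Drt_cospan_td[OF d(1)] by (simp add: closed_mor_def)
  moreover have "cospan_iso c ?g" using c cospan_iso_sym[OF wf, of c] by (simp add: cls_def)
  ultimately have "cospan_td (wd d) ?g" using cospan_td_iso by blast
  then show ?thesis using rooted_td_tw_le[of "wd d" G] d(2) by (simp add: cospan_td_def)
qed

section \<open>From tree decompositions to monoidal decompositions\<close>

text \<open>Induction on the number of nodes: the tree is split at an edge \<open>{r, s}\<close>, and \<open>Ns\<close> is the
  branch at \<open>s\<close>. Acyclicity is subsumed by the condition on bags along all paths.\<close>

lemma decomposition_rooted_td:
  fixes Y :: "('i, 'k) ugraph"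
  assumes "\<And>vs es l. path Y vs es \<Longrightarrow> l \<in> set vs \<Longrightarrow> t (hd vs) \<inter> t (last vs) \<subseteq> t l"
    and "\<And>i. i \<in> verts Y \<Longrightarrow> finite (t i) \<and> card (t i) \<le> k"
    and "finite N" "N \<subseteq> verts Y" "r \<in> N" "\<And>v. v \<in> N \<Longrightarrow> (r, v) \<in> reach Y N"
  shows "rooted_td k en (\<Union>i \<in> N. t i) {e. \<exists>i \<in> N. en e \<subseteq> t i} (t r)"
  using assms(3-)
proof (induction N arbitrary: r rule: finite_psubset_induct)
  case (psubset N)
  show ?case
  proof (cases "N = {r}")
    case True
    then show ?thesis using assms(2)[of r] psubset.prems(1,2) by (auto intro: rooted_td.bag)
  next
    case False
    have "\<exists>s \<in> N. s \<noteq> r \<and> (r, s) \<in> adjacency Y"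
    proof (rule ccontr)
      assume n: "\<not> ?thesis"
      have "v = r" if "(r, v) \<in> reach Y N" for v
        using that by (induction rule: rtrancl_induct) (use n in blast)+
      then show False using False psubset.prems(2,3) by blast
    qed
    then obtain s where s: "s \<in> N" "s \<noteq> r" "(r, s) \<in> adjacency Y" by blast
    \<comment> \<open>Leaving out \<open>r\<close> makes this a branch: inside \<open>N\<close> it
      can be left only through \<open>r\<close>.\<close>
    define Ns where "Ns = {v. (s, v) \<in> reach Y (N - {r})}"
    define Nr where "Nr = N - Ns"
    have Ns: "Ns \<subseteq> N - {r}"
    proof
      fix v assume "v \<in> Ns"
      then have "(s, v) \<in> reach Y (N - {r})" by (simp add: Ns_def)
      then show "v \<in> N - {r}" by (cases rule: rtranclE) (use s in auto)
    qed
    have sNs: "s \<in> Ns" by (simp add: Ns_def)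
    have rNr: "r \<in> Nr" using Ns psubset.prems(2) by (auto simp: Nr_def)
    have N: "N = Nr \<union> Ns" "Nr \<inter> Ns = {}" using Ns by (auto simp: Nr_def)
    have Ns_step: "w \<in> Ns" if "v \<in> Ns" "(v, w) \<in> adjacency Y" "w \<in> N" "w \<noteq> r" for v w
      using that Ns unfolding Ns_def by (auto intro: rtrancl_into_rtrancl)
    have reach_s: "(s, v) \<in> reach Y Ns" if "v \<in> Ns" for v
    proof -
      have "(s, v) \<in> reach Y (N - {r})" using that by (simp add: Ns_def)
      then have "v \<in> Ns \<and> (s, v) \<in> reach Y Ns"
      proof (induction rule: rtrancl_induct)
        case (step v w)
        then have "w \<in> Ns" using Ns_step[of v w] by blast
        then show ?case using step by (auto intro: rtrancl_into_rtrancl)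
      qed (use sNs in simp)
      then show ?thesis by blast
    qed
    \<comment> \<open>A step from \<open>Ns\<close> to the rest of \<open>N\<close> ends at
      \<open>r\<close>, where the connection inside \<open>Nr\<close> starts afresh.\<close>
    have "v \<in> Ns \<or> v \<in> Nr \<and> (r, v) \<in> reach Y Nr" if "(r, v) \<in> reach Y N" for v
      using that
    proof (induction rule: rtrancl_induct)
      case (step v w)
      show ?case
      proof (cases "w \<in> Ns \<or> w = r")
        case False
        then have "v \<notin> Ns" using Ns_step[of v w] step by blast
        then show ?thesis using False step N by (auto intro: rtrancl_into_rtrancl)
      qed (use rNr in auto)
    qed (use rNr in auto)
    then have reach_r: "(r, v) \<in> reach Y Nr" if "v \<in> Nr" for v
      using that psubset.prems(3) N by blast
    obtain e where e: "e \<in> edges Y" "ends Y e = {r, s}" using s by (auto simp: adjacency_def)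
    have sep: "t i \<inter> t j \<subseteq> t r \<inter> t s" if i: "i \<in> Nr" and j: "j \<in> Ns" for i j
    proof -
      have sub: "Nr \<subseteq> verts Y" "Ns \<subseteq> verts Y" using N psubset.prems(1) by auto
      obtain vs es where v: "path Y vs es" "hd vs = r" "last vs = i" "set vs \<subseteq> Nr"
        using reach_path[OF reach_r[OF i] rNr sub(1)] by blast
      obtain ws fs where w: "path Y ws fs" "hd ws = s" "last ws = j" "set ws \<subseteq> Ns"
        using reach_path[OF reach_s[OF j] sNs sub(2)] by blast
      have ne: "vs \<noteq> []" "ws \<noteq> []" using v(1) w(1) by (auto simp: path_def walk_def)
      \<comment> \<open>As \<open>Nr\<close> and \<open>Ns\<close> are disjoint, concatenation
        across \<open>e\<close> gives a path from \<open>i\<close> to \<open>j\<close> on which both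
        \<open>r\<close> and \<open>s\<close> lie.\<close>
      have "walk Y (rev vs @ ws) (rev es @ e # fs)"
        using v w e by (intro walk_append walk_rev) (auto simp: path_def last_rev)
      moreover have "distinct (rev vs @ ws)" using v w N(2) by (auto simp: path_def)
      ultimately have "path Y (rev vs @ ws) (rev es @ e # fs)" by (simp add: path_def)
      moreover have "r \<in> set (rev vs @ ws)" "s \<in> set (rev vs @ ws)"
        using v(2) w(2) ne hd_in_set by fastforce+
      ultimately show ?thesis
        using assms(1)[of "rev vs @ ws" "rev es @ e # fs"] v(3) w(3) ne
        by (simp add: hd_append hd_rev last_rev)
    qed
    have "rooted_td k en (\<Union>i \<in> Nr. t i) {e. \<exists>i \<in> Nr. en e \<subseteq> t i} (t r)"
      using N sNs psubset.prems(1) rNr reach_r by (intro psubset.IH) auto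
    \<comment> \<open>The bag \<open>t r\<close> is repeated on top of the branch so that both parts
      have the same root; edges inside it are already counted in the part of
      \<open>Nr\<close>.\<close>
    moreover have "rooted_td k en ((\<Union>i \<in> Ns. t i) \<union> t r) ({e. \<exists>i \<in> Ns. en e \<subseteq> t i} \<union> {}) (t r)"
    proof (rule rooted_td.reroot)
      show "rooted_td k en (\<Union>i \<in> Ns. t i) {e. \<exists>i \<in> Ns. en e \<subseteq> t i} (t s)"
        using N rNr psubset.prems(1) sNs reach_s by (intro psubset.IH) auto
      show "t r \<inter> (\<Union>i \<in> Ns. t i) \<subseteq> t s" using sep[OF rNr] by blast
    qed (use assms(2) psubset.prems(1,2) in auto)
    moreover have "(\<Union>i \<in> Nr. t i) \<inter> ((\<Union>i \<in> Ns. t i) \<union> t r) = t r" using sep rNr by blast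
    ultimately have "rooted_td k en ((\<Union>i \<in> Nr. t i) \<union> ((\<Union>i \<in> Ns. t i) \<union> t r))
        ({e. \<exists>i \<in> Nr. en e \<subseteq> t i} \<union> ({e. \<exists>i \<in> Ns. en e \<subseteq> t i} \<union> {})) (t r)"
      by (rule rooted_td.join)
    moreover have "(\<Union>i \<in> Nr. t i) \<union> ((\<Union>i \<in> Ns. t i) \<union> t r) = (\<Union>i \<in> N. t i)" using N rNr by blast
    moreover have "{e. \<exists>i \<in> Nr. en e \<subseteq> t i} \<union> ({e. \<exists>i \<in> Ns. en e \<subseteq> t i} \<union> {}) =
        {e. \<exists>i \<in> N. en e \<subseteq> t i}" using N by blast
    ultimately show ?thesis by simp
  qed
qed

text \<open>\<open>E\<close> collects everything whose \<open>ends\<close> fit into a bag, and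
  \<open>ends G\<close> has values outside \<open>edges G\<close> too; hence only an
  inclusion.\<close>

lemma tree_decomposition_rooted_td:
  assumes td: "tree_decomposition G Y t" and wf: "wf_ugraph G"
  obtains E R where "rooted_td (td_width Y t) (ends G) (verts G) E R" "edges G \<subseteq> E"
proof -
  have fin: "finite (verts Y)" and conn: "connected_graph Y"
    using td by (auto simp: tree_decomposition_def tree_def wf_ugraph_def)
  then obtain r where r: "r \<in> verts Y" by (auto simp: connected_graph_def)
  have 1: "finite (t i) \<and> card (t i) \<le> td_width Y t" if "i \<in> verts Y" for i
  proof
    have "t i \<subseteq> verts G" using td that by (auto simp: tree_decomposition_def)
    then show "finite (t i)" using wf by (auto simp: wf_ugraph_def intro: finite_subset)
    show "card (t i) \<le> td_width Y t" unfolding td_width_def using fin that by (intro Max_ge) auto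
  qed
  have 2: "(r, v) \<in> reach Y (verts Y)" if "v \<in> verts Y" for v
  proof -
    obtain vs es where "path Y vs es" "hd vs = r" "last vs = v"
      using conn r \<open>v \<in> verts Y\<close> unfolding connected_graph_def by blast
    then show ?thesis using walk_reach[of Y vs es] by (simp add: path_def)
  qed
  have 3: "t (hd vs) \<inter> t (last vs) \<subseteq> t l" if "path Y vs es" "l \<in> set vs" for vs es l
    using td that unfolding tree_decomposition_def by blast
  have "rooted_td (td_width Y t) (ends G) (\<Union>i \<in> verts Y. t i)
      {e. \<exists>i \<in> verts Y. ends G e \<subseteq> t i} (t r)"
    using 3 1 fin order_refl r 2 by (rule decomposition_rooted_td)
  moreover have V: "(\<Union>i \<in> verts Y. t i) = verts G"
    and E: "edges G \<subseteq> {e. \<exists>i \<in> verts Y. ends G e \<subseteq> t i}"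
    using td by (auto simp: tree_decomposition_def)
  ultimately show thesis by (intro that[OF _ E]) (simp only: V)
qed

section \<open>Presenting a cospan as a composite\<close>

text \<open>The isomorphism is the universal map of the pushout: on vertices \<open>comm\<close>
  makes it well defined, \<open>verts\<close> surjective and \<open>kernel\<close> injective.
  Applications need not compute any closure.\<close>

lemma cospan_seq_isoI:
  assumes verts: "pV ` verts (apex f) \<union> qV ` verts (apex g) = verts (apex k)"
    and edges: "bij_betw (case_sum pE qE) (edges (apex f) <+> edges (apex g)) (edges (apex k))"
    and endsf: "\<And>e. e \<in> edges (apex f) \<Longrightarrow> ends (apex k) (pE e) = pV ` ends (apex f) e"
    and endsg: "\<And>e. e \<in> edges (apex g) \<Longrightarrow> ends (apex k) (qE e) = qV ` ends (apex g) e"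
    and comm: "\<And>c. c \<in> tgt f \<Longrightarrow> pV (legr f c) = qV (legl g c)"
    and kernel: "\<And>x y. x \<in> verts (apex f) <+> verts (apex g) \<Longrightarrow>
      y \<in> verts (apex f) <+> verts (apex g) \<Longrightarrow> case_sum pV qV x = case_sum pV qV y \<Longrightarrow>
      glue f g x = glue f g y"
    and src: "src k = src f" "\<And>x. x \<in> src f \<Longrightarrow> legl k x = pV (legl f x)"
    and tgt: "tgt k = tgt g" "\<And>y. y \<in> tgt g \<Longrightarrow> legr k y = qV (legr g y)"
  shows "cospan_iso (cospan_seq f g) k"
proof -
  have "pE ` edges (apex f) \<union> qE ` edges (apex g) = edges (apex k)"
    using bij_betw_imp_surj_on[OF edges] by (simp add: Plus_def image_Un image_image)
  then have "ugraph_hom pV pE (apex f) (apex k)" "ugraph_hom qV qE (apex g) (apex k)"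
    using verts endsf endsg by (auto simp: ugraph_hom_def)
  from pushout_universal[OF this comm]
  obtain uV uE where u: "ugraph_hom uV uE (pushout_graph f g) (apex k)"
    "\<And>v. uV (glue f g (Inl v)) = pV v" "\<And>w. uV (glue f g (Inr w)) = qV w"
    "\<And>e. uE (Inl e) = pE e" "\<And>e. uE (Inr e) = qE e"
    by blast
  have uV: "uV (glue f g x) = case_sum pV qV x" for x using u by (cases x) auto
  have "uE = case_sum pE qE" using u by (auto simp: fun_eq_iff split: sum.split)
  then have "bij_betw uE (edges (pushout_graph f g)) (edges (apex k))"
    using edges by (simp add: pushout_graph_def)
  moreover have "bij_betw uV (verts (pushout_graph f g)) (verts (apex k))"
    unfolding bij_betw_def
  proof
    show "inj_on uV (verts (pushout_graph f g))"
    proof (rule inj_onI)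
      fix X Y assume "X \<in> verts (pushout_graph f g)" "Y \<in> verts (pushout_graph f g)" "uV X = uV Y"
      moreover from this(1,2) obtain x y where
        "x \<in> verts (apex f) <+> verts (apex g)" "X = glue f g x"
        "y \<in> verts (apex f) <+> verts (apex g)" "Y = glue f g y"
        unfolding pushout_graph_def by auto
      ultimately show "X = Y" using kernel[of x y] uV by simp
    qed
    show "uV ` verts (pushout_graph f g) = verts (apex k)"
      using verts by (simp add: pushout_graph_def image_image uV Plus_def image_Un)
  qed
  ultimately have "ugraph_iso uV uE (pushout_graph f g) (apex k)"
    using u(1) by (simp add: ugraph_iso_def)
  then show ?thesis
    unfolding cospan_iso_def using src tgt u(2,3)
    by (intro conjI exI[of _ uV] exI[of _ uE]) (auto simp: cospan_seq_def)
qed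

lemma cls_hom:
  assumes "wf_cospan f"
  shows "cls f \<in> hom (src f) (tgt f)"
proof -
  obtain c where c: "c \<in> cls f" using cls_nonempty[OF assms] by blast
  then have "wf_cospan c" and iso: "cospan_iso f c" by (simp_all add: cls_def)
  moreover from iso have "src c = src f" "tgt c = tgt f" by (simp_all add: cospan_iso_def)
  ultimately show ?thesis using cls_eqI[OF assms iso] by (auto simp: hom_def)
qed

text \<open>\<open>Drt.tensor\<close> prescribes a coherence on both sides. Where the boundaries
  already fit, identities are inserted, and the two unit laws remove them again.\<close>

lemma seq_ident_left:
  assumes "wf_cospan f"
  shows "mor_of_fun (src f) (src f) id ;; cls f = cls f"
proof -
  let ?i = "\<lparr>src = src f, tgt = src f, apex = discrete (src f), legl = id, legr = id\<rparr>"
  have wf: "wf_cospan ?i" using assms by (simp add: wf_cospan_def wf_ugraph_def discrete_def)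
  have leg: "glue ?i f (Inl c) = glue ?i f (Inr (legl f c))" if "c \<in> src f" for c
    using glue_legs[of c ?i f] that by simp
  have "cospan_iso (cospan_seq ?i f) f"
  \<comment> \<open>A discrete apex has no edges, so its edge map may be
    \<open>undefined\<close>.\<close>
  proof (rule cospan_seq_isoI[where pV = "legl f" and qV = id and pE = undefined and qE = id])
    show "bij_betw (case_sum undefined id) (edges (apex ?i) <+> edges (apex f)) (edges (apex f))"
      by (auto simp: discrete_def bij_betw_def inj_on_def Plus_def image_image)
    fix x y assume "x \<in> verts (apex ?i) <+> verts (apex f)" "y \<in> verts (apex ?i) <+> verts (apex f)"
      "case_sum (legl f) id x = case_sum (legl f) id y"
    then show "glue ?i f x = glue ?i f y" using leg by (auto simp: discrete_def)
  qed (use assms in \<open>auto simp: wf_cospan_def discrete_def\<close>)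
  moreover have "mor_of_fun (src f) (src f) id ;; cls f = cls (cospan_seq ?i f)"
    unfolding mor_of_fun_def using wf assms by (intro seq_cls) auto
  ultimately show ?thesis using cls_eqI[OF wf_cospan_seq[OF wf assms]] by simp
qed

lemma seq_ident_right:
  assumes "wf_cospan f"
  shows "cls f ;; mor_of_fun (tgt f) (tgt f) id = cls f"
proof -
  let ?i = "\<lparr>src = tgt f, tgt = tgt f, apex = discrete (tgt f), legl = id, legr = id\<rparr>"
  have wf: "wf_cospan ?i" using assms by (simp add: wf_cospan_def wf_ugraph_def discrete_def)
  have leg: "glue f ?i (Inr c) = glue f ?i (Inl (legr f c))" if "c \<in> tgt f" for c
    using glue_legs[of c f ?i] that by simp
  have "cospan_iso (cospan_seq f ?i) f"
  proof (rule cospan_seq_isoI[where pV = id and qV = "legr f" and pE = id and qE = undefined])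
    show "bij_betw (case_sum id undefined) (edges (apex f) <+> edges (apex ?i)) (edges (apex f))"
      by (auto simp: discrete_def bij_betw_def inj_on_def Plus_def image_image)
    fix x y assume "x \<in> verts (apex f) <+> verts (apex ?i)" "y \<in> verts (apex f) <+> verts (apex ?i)"
      "case_sum id (legr f) x = case_sum id (legr f) y"
    then show "glue f ?i x = glue f ?i y" using leg by (auto simp: discrete_def)
  qed (use assms in \<open>auto simp: wf_cospan_def discrete_def\<close>)
  moreover have "cls f ;; mor_of_fun (tgt f) (tgt f) id = cls (cospan_seq f ?i)"
    unfolding mor_of_fun_def using wf assms by (intro seq_cls) auto
  ultimately show ?thesis using cls_eqI[OF wf_cospan_seq[OF assms wf]] by simp
qed

section \<open>Building the monoidal decomposition\<close>

text \<open>Objects are sets of \<open>elem\<close>, while bags consist of vertices of any type; a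
  bag has to be indexed before it can serve as a boundary.\<close>

lemma elem_indexing:
  assumes "finite X"
  obtains B :: "elem set" and \<beta> where "finite B" "bij_betw \<beta> B X"
proof -
  obtain h :: "'a \<Rightarrow> nat" where h: "inj_on h X" using finite_imp_inj_to_nat_seg[OF assms] by metis
  then have "bij_betw (Point \<circ> h) X ((Point \<circ> h) ` X)" by (auto simp: bij_betw_def inj_on_def)
  then show thesis using that assms bij_betw_inv by (metis finite_imageI)
qed

text \<open>All pieces keep the vertex type and the function \<open>en\<close> of the ambient graph,
  so the maps from the pieces to a composite are identities.\<close>

definition closing ::
  "('e \<Rightarrow> 'v set) \<Rightarrow> elem set \<Rightarrow> 'v set \<Rightarrow> 'e set \<Rightarrow> (elem \<Rightarrow> 'v) \<Rightarrow> ('v, 'e) cospan" where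
  "closing en A V E l =
     \<lparr>src = A, tgt = {}, apex = \<lparr>verts = V, edges = E, ends = en\<rparr>, legl = l,
      legr = (\<lambda>_. undefined)\<rparr>"

text \<open>Edges and left boundary are left free: the induction hands each part only some of its
  possible edges, and the boundary of a part may be any finite set mapped into its root. No bound on
  \<open>card A\<close> is asked, since only a composition further out charges it.\<close>

lemma Drt_exists:
  fixes en :: "'e \<Rightarrow> 'v set"
  assumes "rooted_td k en V E R"
    and "F \<subseteq> E" "finite F" "\<And>e. e \<in> F \<Longrightarrow> card (en e) \<in> {1, 2}" "finite A" "l ` A \<subseteq> R"
  shows "\<exists>d. Drt A {} (cls (closing en A V F l)) d \<and> wd d \<le> 2 * k"
  using assms
proof (induction arbitrary: F A l rule: rooted_td.induct)
  case (bag R E)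
  then have wf: "wf_cospan (closing en A R F l)"
    by (auto simp: wf_cospan_def wf_ugraph_def closing_def)
  have "Drt A {} (cls (closing en A R F l)) (Leaf (cls (closing en A R F l)))"
    using cls_hom[OF wf] by (intro Drt.leaf) (simp add: closing_def)
  moreover have "weight (cls (closing en A R F l)) \<le> 2 * k"
    using weight_cls[OF wf] bag.hyps(2) by (simp add: closing_def)
  ultimately show ?case by (metis wd.simps(1))
next
  case (reroot V E R R' E')
  \<comment> \<open>An edge may fit on both sides, but the edge map must be bijective, so it goes to
    the old part. The composition runs along the shared vertices only, at most \<open>k\<close> of
    them.\<close>
  let ?F0 = "F \<inter> E" and ?F1 = "F - E" and ?X = "R' \<inter> V"
  obtain B :: "elem set" and \<beta> where \<beta>: "finite B" "bij_betw \<beta> B ?X"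
    using elem_indexing[of ?X] reroot.hyps(2) by blast
  have img: "\<beta> ` B = ?X" using \<beta>(2) by (simp add: bij_betw_def)
  have "card B = card ?X" using \<beta>(2) by (rule bij_betw_same_card)
  also have "\<dots> \<le> card R'" using reroot.hyps(2) by (intro card_mono) auto
  finally have cB: "card B \<le> k" using reroot.hyps(3) by simp
  obtain d where d: "Drt B {} (cls (closing en B V ?F0 \<beta>)) d" "wd d \<le> 2 * k"
    using reroot.IH[of ?F0 B \<beta>] reroot.prems \<beta>(1) img reroot.hyps(4) by auto
  define h where "h = \<lparr>src = A, tgt = B, apex = \<lparr>verts = R', edges = ?F1, ends = en\<rparr>,
    legl = l, legr = \<beta>\<rparr>"
  let ?g = "closing en B V ?F0 \<beta>" and ?k = "closing en A (V \<union> R') F l"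
  have en1: "\<forall>e \<in> ?F1. en e \<subseteq> R'" using reroot.prems(1) reroot.hyps(5) by auto
  have en0: "\<forall>e \<in> ?F0. en e \<subseteq> V" using rooted_td_ends[OF reroot.hyps(1)] by blast
  have wfh: "wf_cospan h"
    using reroot.prems reroot.hyps(2) img \<beta>(1) en1 by (auto simp: wf_cospan_def wf_ugraph_def h_def)
  have wfg: "wf_cospan ?g"
    using reroot.prems rooted_td_finite[OF reroot.hyps(1)] img \<beta>(1) en0
    by (auto simp: wf_cospan_def wf_ugraph_def closing_def)
  have glue: "glue h ?g (Inl x) = glue h ?g (Inr x)" if "x \<in> R'" "x \<in> V" for x
  proof -
    obtain c where "c \<in> B" "x = \<beta> c" using \<open>x \<in> R'\<close> \<open>x \<in> V\<close> img by blast
    then show ?thesis using glue_legs[of c h ?g] by (simp add: h_def closing_def)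
  qed
  have "cospan_iso (cospan_seq h ?g) ?k"
  proof (rule cospan_seq_isoI[where pV = id and qV = id and pE = id and qE = id])
    show "bij_betw (case_sum id id) (edges (apex h) <+> edges (apex ?g)) (edges (apex ?k))"
      by (auto simp: bij_betw_def inj_on_def h_def closing_def Plus_def image_Un image_image)
    fix x y assume "x \<in> verts (apex h) <+> verts (apex ?g)" "y \<in> verts (apex h) <+> verts (apex ?g)"
      "case_sum id id x = case_sum id id y"
    then show "glue h ?g x = glue h ?g y" using glue by (auto simp: h_def closing_def)
  qed (auto simp: h_def closing_def)
  then have "cls (cospan_seq h ?g) = cls ?k" by (intro cls_eqI wf_cospan_seq wfh wfg)
  moreover have "cls h ;; cls ?g = cls (cospan_seq h ?g)"
    using wfh wfg by (intro seq_cls) (simp_all add: h_def closing_def)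
  moreover have "cls h \<in> hom A B" using cls_hom[OF wfh] by (simp add: h_def)
  ultimately have "Drt A {} (cls ?k) (Comp (cls h) B d)" using Drt.comp d(1) by metis
  moreover have "weight (cls h) \<le> k" using weight_cls[OF wfh] reroot.hyps(3) by (simp add: h_def)
  ultimately show ?case using d(2) cB by (intro exI[of _ "Comp (cls h) B d"]) auto
next
  case (join V1 E1 R V2 E2)
  let ?F1 = "F \<inter> E1" and ?F2 = "F - E1"
  have R: "finite R" "card R \<le> k" using rooted_td_root[OF join.hyps(1)] by auto
  obtain B :: "elem set" and \<beta> where \<beta>: "finite B" "bij_betw \<beta> B R"
    using elem_indexing[OF R(1)] by blast
  have img: "\<beta> ` B = R" using \<beta>(2) by (simp add: bij_betw_def)
  have cB: "card B = card R" using \<beta>(2) by (rule bij_betw_same_card)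
  let ?g1 = "closing en B V1 ?F1 \<beta>" and ?g2 = "closing en B V2 ?F2 \<beta>"
  let ?C = "B \<oplus>\<^sub>o B" and ?g = "cospan_par ?g1 ?g2" and ?k = "closing en A (V1 \<union> V2) F l"
  obtain d1 where d1: "Drt B {} (cls ?g1) d1" "wd d1 \<le> 2 * k"
    using join.IH(1)[of ?F1 B \<beta>] join.prems \<beta>(1) img by auto
  obtain d2 where d2: "Drt B {} (cls ?g2) d2" "wd d2 \<le> 2 * k"
    using join.IH(2)[of ?F2 B \<beta>] join.prems \<beta>(1) img by auto
  have RV: "R \<subseteq> V1" "R \<subseteq> V2" using join.hyps(3) by auto
  have en: "\<forall>e \<in> ?F1. en e \<subseteq> V1" "\<forall>e \<in> ?F2. en e \<subseteq> V2"
    using rooted_td_ends[OF join.hyps(1)] rooted_td_ends[OF join.hyps(2)] join.prems(1) by blast+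
  have wf12: "wf_cospan ?g1" "wf_cospan ?g2"
    using join.prems rooted_td_finite[OF join.hyps(1)] rooted_td_finite[OF join.hyps(2)] img \<beta>(1) en RV
    by (auto simp: wf_cospan_def wf_ugraph_def closing_def)
  have wfg: "wf_cospan ?g" using wf12 by (rule wf_cospan_par)
  have st: "src ?g = ?C" "tgt ?g = {}" by (auto simp: cospan_par_def closing_def osum_def)
  have empty: "{} \<oplus>\<^sub>o {} = {}" by (simp add: osum_def)
  have fC: "finite ?C" using \<beta>(1) by (simp add: finite_osum)
  have "Drt ?C {} (mor_of_fun ?C ?C id ;; cls ?g1 \<otimes>\<^sub>m cls ?g2 ;; mor_of_fun {} {} id) (Tensor d1 d2)"
    using d1(1) d2(1)
  proof (rule Drt.tensor)
    show "coherence ?C ?C (mor_of_fun ?C ?C id)" using fC by (rule coherence.ident)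
    show "coherence ({} \<oplus>\<^sub>o {}) {} (mor_of_fun {} {} id)"
      unfolding empty by (rule coherence.ident) simp
  qed
  then have d: "Drt ?C {} (cls ?g) (Tensor d1 d2)"
    using seq_ident_left[OF wfg] seq_ident_right[OF wfg] by (simp add: par_cls[OF wf12] st)
  \<comment> \<open>The right leg is the codiagonal on two copies of \<open>B\<close>: each vertex
    of \<open>R\<close> is a boundary point once for each branch, while the apex has only
    \<open>card R\<close> vertices.\<close>
  define h where "h = \<lparr>src = A, tgt = ?C, apex = \<lparr>verts = R, edges = {} :: 'e set, ends = en\<rparr>,
    legl = l, legr = elem_case \<beta> \<beta>\<rparr>"
  have wfh: "wf_cospan h"
    using join.prems R fC img by (auto simp: wf_cospan_def wf_ugraph_def h_def osum_def)
  have glue: "glue h ?g (Inl x) = glue h ?g (Inr (Inl x))" "glue h ?g (Inl x) = glue h ?g (Inr (Inr x))"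
    if "x \<in> R" for x
  proof -
    obtain c where "c \<in> B" "x = \<beta> c" using \<open>x \<in> R\<close> img by blast
    then show "glue h ?g (Inl x) = glue h ?g (Inr (Inl x))"
      "glue h ?g (Inl x) = glue h ?g (Inr (Inr x))"
      using glue_legs[of "InL c" h ?g] glue_legs[of "InR c" h ?g]
      by (simp_all add: h_def closing_def cospan_par_def osum_def)
  qed
  have "cospan_iso (cospan_seq h ?g) ?k"
  proof (rule cospan_seq_isoI[where pV = id and qV = "case_sum id id" and pE = id and qE = "case_sum id id"])
    show "bij_betw (case_sum id (case_sum id id)) (edges (apex h) <+> edges (apex ?g)) (edges (apex ?k))"
      by (auto simp: bij_betw_def inj_on_def h_def closing_def cospan_par_def sum_graph_def image_image
          Plus_def image_Un)
    fix x y assume "x \<in> verts (apex h) <+> verts (apex ?g)" "y \<in> verts (apex h) <+> verts (apex ?g)"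
      "case_sum id (case_sum id id) x = case_sum id (case_sum id id) y"
    \<comment> \<open>Equal vertices from different branches lie in
      \<open>V1 \<inter> V2 = R\<close>, so they are glued through \<open>h\<close>.\<close>
    then show "glue h ?g x = glue h ?g y"
      using glue join.hyps(3) by (auto simp: h_def closing_def cospan_par_def sum_graph_def)
  qed (use RV in \<open>auto simp: h_def closing_def cospan_par_def sum_graph_def osum_def image_image Plus_def image_Un\<close>)
  then have "cls (cospan_seq h ?g) = cls ?k" by (intro cls_eqI wf_cospan_seq wfh wfg)
  moreover have "cls h ;; cls ?g = cls (cospan_seq h ?g)"
    using wfh wfg by (rule seq_cls) (simp add: h_def st)
  moreover have "cls h \<in> hom A ?C" using cls_hom[OF wfh] by (simp add: h_def)
  ultimately have "Drt A {} (cls ?k) (Comp (cls h) ?C (Tensor d1 d2))" using Drt.comp d by metis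
  moreover have "weight (cls h) \<le> k" using weight_cls[OF wfh] R(2) by (simp add: h_def)
  moreover have "card ?C \<le> 2 * k" using card_osum[OF \<beta>(1) \<beta>(1)] cB R(2) by simp
  ultimately show ?case using d1(2) d2(2)
    by (intro exI[of _ "Comp (cls h) ?C (Tensor d1 d2)"]) auto
qed

lemma mtwd_le_tw:
  assumes "wf_ugraph G"
  shows "mtwd {} {} (closed_mor G) \<le> 2 * tw G"
proof -
  let ?Y = "\<lparr>verts = {0}, edges = {}, ends = \<lambda>_. {}\<rparr> :: (nat, nat) ugraph"
  let ?P = "\<lambda>w. \<exists>(Y :: (nat, nat) ugraph) t. tree_decomposition G Y t \<and> w = td_width Y t"
  have "tree_decomposition G ?Y (\<lambda>_. verts G)"
    using assms by (intro tree_decomposition_single) (simp add: wf_ugraph_def)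
  then have "?P (td_width ?Y (\<lambda>_. verts G))" by blast
  then have "?P (tw G)" unfolding tw_def by (rule LeastI)
  then obtain Y :: "(nat, nat) ugraph" and t where Y: "tree_decomposition G Y t" "tw G = td_width Y t"
    by blast
  obtain E R where E: "rooted_td (tw G) (ends G) (verts G) E R" "edges G \<subseteq> E"
    using tree_decomposition_rooted_td[OF Y(1) assms] Y(2) by metis
  have apex: "\<lparr>verts = verts G, edges = edges G, ends = ends G\<rparr> = G" by simp
  \<comment> \<open>With empty boundaries and this leg, \<open>closing\<close> unfolds to the very
    cospan in \<open>closed_mor G\<close>.\<close>
  have "\<exists>d. Drt {} {} (cls (closing (ends G) {} (verts G) (edges G) (\<lambda>_. undefined))) d \<and>
      wd d \<le> 2 * tw G"
    using assms by (intro Drt_exists[OF E]) (auto simp: wf_ugraph_def)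
  then obtain d where d: "Drt {} {} (closed_mor G) d" "wd d \<le> 2 * tw G"
    unfolding closing_def closed_mor_def apex by blast
  have "mtwd {} {} (closed_mor G) \<le> wd d" unfolding mtwd_def using d(1) by (intro Least_le) blast
  then show ?thesis using d(2) by simp
qed

theorem theorem41:
  fixes G :: "('v, 'e) ugraph"
  assumes "wf_ugraph G"
  shows "tw G \<le> mtwd {} {} (closed_mor G) \<and> mtwd {} {} (closed_mor G) \<le> 2 * tw G"
  using tw_le_mtwd[OF assms] mtwd_le_tw[OF assms] ..

end
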